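(* Consider the optimal control problem $(OCP)$ described in the context. Assume that: (1) the Lagrangian $L$ is regular; (2) the density cost $C$ is uniformly coercive in $u$ (with respect to $(q,p)$) and smooth in $(q,p)$; (3) $(OCP)$ has a unique solution $(q^*,p^*,u^* )$; (4) $\frac{\partial^2\mathcal{H}}{\partial u^2}(q^*,p^*,u^*,\lambda,\psi,1)$ is a positive definite symmetric matrix, where $(\lambda,\psi)$ are the adjoint variables associated with $(q^*,p^*,u^* )$. If a convergent symplectic Galerkin (sG) method with $b_i>0$, $i=1,\dots,s$, is used for the discretization of the state system, then dualization and discretization commute. That is, the dualization of the discrete optimal control problem $(OCP)_h^{sG}$ (its constraints together with its KKT equations, written in the transformed multipliers $\Gamma_i^k=\Lambda_i^k/\bar b_i$, $\chi_i^k=\Psi_i^k/\bar b_i$, $\psi_k$, and with the control eliminated by $U_i^k=u(Q_i^k,P_i^k,\Gamma_i^k,\chi_i^k)$) coincides with the sG discretization of the boundary value problem $$\dot q=f(q,p),\quad \dot p=g(q,p,\lambda,\psi),\quad \dot\lambda=\nu(q,p,\lambda,\psi),\quad\dot\psi=\eta(q,p,\lambda,\psi),$$ $$q(0)=q^0,\quad p(0)=p^0,\quad \lambda(T)=\nabla_q\Phi(q(T),p(T)),\quad \psi(T)=\nabla_p\Phi(q(T),p(T)),$$ namely with the system, for $k=0,\dots,N-1$, $i=1,\dots,s$, $$q_k=\sum_{j=1}^s\alpha^jQ_j^k,\quad q_{k+1}=\sum_{j=1}^s\beta^jQ_j^k,\quad \psi_k=\sum_{j=1}^s\alpha^j\chi_j^k,\quad\psi_{k+1}=\sum_{j=1}^s\beta^j\chi_j^k,$$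 $$f(Q_i^k,P_i^k)=\frac1h\sum_{j=1}^sa_{ij}Q_j^k,\qquad g(Q_i^k,P_i^k,\Gamma_i^k,\chi_i^k)=\frac{\beta^ip_{k+1}-\alpha^ip_k}{h\bar b_i}+\frac1h\sum_{j=1}^s\bar a_{ij}P_j^k,$$ $$\eta(Q_i^k,P_i^k,\Gamma_i^k,\chi_i^k)=\frac1h\sum_{j=1}^sa_{ij}\chi_j^k,\qquad \nu(Q_i^k,P_i^k,\Gamma_i^k,\chi_i^k)=\frac{\beta^i\lambda_{k+1}-\alpha^i\lambda_k}{h\bar b_i}+\frac1h\sum_{j=1}^s\bar a_{ij}\Gamma_j^k,$$ $$q_0=q^0,\quad p_0=p^0,\quad\lambda_N=\nabla_q\Phi(q_N,p_N),\quad\psi_N=\nabla_p\Phi(q_N,p_N).$$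
   Context: **Setting.** $Q\subseteq\mathbb{R}^n$ is the configuration manifold, $L\colon TQ\to\mathbb{R}$ a Lagrangian, $F\colon TQ\times U\to T^*Q$ an external control force, $U\subset\mathbb{R}^m$ closed and convex, $T>0$ fixed, $(q^0,p^0)\in T^*Q$ given. $L$ is *regular* if $\partial^2L/\partial\dot q^2$ is non-degenerate; the Legendre transform $p=\frac{\partial L}{\partial\dot q}(q,\dot q)$ is assumed to be (locally) invertible with inverse $\dot q=\left(\frac{\partial L}{\partial\dot q}\right)^{-1}(q,p)$. Put $f(q,p)=\left(\frac{\partial L}{\partial\dot q}\right)^{-1}(q,p)$ and $g(q,p,u)=\frac{\partial L}{\partial q}(q,f(q,p))+F(q,f(q,p),u)$; $f,g$ are Lipschitz continuous (and differentiable, so that the gradients below exist). The costs $C\colon T^*Q\times U\to\mathbb{R}$ and $\Phi\colon T^*Q\to\mathbb{R}$ are continuously differentiable, with $\Phi$ bounded from below. $C$ is uniformly coercive in $u$ if there is $\alpha>0$, independent of $(q,p)$, with $\liminf_{\|u\|\to\infty}C(q,p,u)/\|u\|^2\ge\alpha$. **$(OCP)$.** Minimize $J(q,p,u)=\int_0^TC(q,p,u)\,dt+\Phi(q(T),p(T))$ subject to $\dot q=f(q,p)$, $q(0)=q^0$, $\dot p=g(q,p,u)$, $p(0)=p^0$, over $q\in W^{2,\infty}([0,T],Q)$, $p\in W^{1,\infty}([0,T],T_q^*Q)$, $u\in L^\infty([0,T],U)$. Standing assumption: all controls under consideration lie in the interior of the control constraint set $U$. **Hamiltonian and adjoints.**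 $\mathcal{H}(q,p,u,\lambda,\psi,\rho_0)=\rho_0C(q,p,u)+\lambda\cdot f(q,p)+\psi\cdot g(q,p,u)$, with $\lambda,\psi$ covectors in $\mathbb{R}^n$. The necessary optimality conditions (Pontryagin, with $\rho_0=1$) are $\dot\lambda=-\nabla_q\mathcal{H}$, $\dot\psi=-\nabla_p\mathcal{H}$, $\lambda(T)=\nabla_q\Phi(q(T),p(T))$, $\psi(T)=\nabla_p\Phi(q(T),p(T))$ and $0=\nabla_uC+\psi\cdot\nabla_ug$. Here $\lambda\cdot\nabla_qf$ etc. denote covector times Jacobian. Under assumption (4), the last equation lets one express $u$ as a function $u=u(q,p,\lambda,\psi)$. Define $$\nu(q,p,\lambda,\psi)=\left(-\nabla_qC-\lambda\cdot\nabla_qf-\psi\cdot\nabla_qg\right)|_{u=u(q,p,\lambda,\psi)},$$ $$\eta(q,p,\lambda,\psi)=\left(-\nabla_pC-\lambda\cdot\nabla_pf-\psi\cdot\nabla_pg\right)|_{u=u(q,p,\lambda,\psi)},$$ and, abusing notation, $g(q,p,\lambda,\psi)=g(q,p,u(q,p,\lambda,\psi))$. **sG coefficients.** For collocation points $0\le c_1<\dots<c_s\le1$: $l^j(t)=\prod_{i\ne j}\frac{t-c_i}{c_j-c_i}$, $b_j=\bar b_j=\int_0^1l^j(t)\,dt$, $a_{ij}=\frac{dl^j}{dt}(c_i)$, $\alpha^j=l^j(0)$, $\beta^j=l^j(1)$, and $\bar a_{ij}$ defined by $b_ia_{ij}+\bar b_j\bar a_{ji}=0$. The sG method is called convergent if,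 as $h\to0$, its discrete trajectories for the state system (for fixed control) converge to the exact solution. In the sG discretization of the boundary value problem, the variables $(q,\psi)$ are both treated as $q$ is in the discrete state equations below, and $(p,\lambda)$ are both treated as $p$ is. **$(OCP)_h^{sG}$.** With $h=T/N$, minimize $\sum_{k=0}^{N-1}h\sum_{i=1}^sb_iC(Q_i^k,P_i^k,U_i^k)+\Phi(q_N,p_N)$ over $q_k,p_k$ ($0\le k\le N$) and $Q_i^k,P_i^k,U_i^k$ ($0\le k\le N-1$, $1\le i\le s$) subject to $(q_0,p_0)=(q^0,p^0)$, $U_i^k\in U$, and $$q_k=\sum_j\alpha^jQ_j^k,\quad q_{k+1}=\sum_j\beta^jQ_j^k,\quad f(Q_i^k,P_i^k)=\frac1h\sum_ja_{ij}Q_j^k,\quad g(Q_i^k,P_i^k,U_i^k)=\frac{\beta^ip_{k+1}-\alpha^ip_k}{h\bar b_i}+\frac1h\sum_j\bar a_{ij}P_j^k.$$ **Dualization of $(OCP)_h^{sG}$.** With discrete adjoint vectors $\lambda_0,\dots,\lambda_N$, $\mu_0,\dots,\mu_{N-1}$, $\psi_0$, $\Lambda_i^k$, $\Psi_i^k$ (covectors in $\mathbb{R}^n$), and writing $C_i^k=C(Q_i^k,P_i^k,U_i^k)$, $f_i^k=f(Q_i^k,P_i^k)$, $g_i^k=g(Q_i^k,P_i^k,U_i^k)$, the discrete optimal control Lagrangian is $$\mathcal{L}_d=\sum_{k=0}^{N-1}\sum_{i=1}^shb_iC_i^k+\Phi(q_N,p_N)-\lambda_0\cdot(q_0-q^0)-\psi_0\cdot(p_0-p^0)+\sum_{k=0}^{N-1}\Big[\mu_k\cdot\Big(q_k-\sum_j\alpha^jQ_j^k\Big)-\lambda_{k+1}\cdot\Big(q_{k+1}-\sum_j\beta^jQ_j^k\Big)$$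 $$+\sum_{i=1}^s\Big(\Lambda_i^k\cdot\Big(hf_i^k-\sum_ja_{ij}Q_j^k\Big)+\Psi_i^k\cdot\Big(hg_i^k-\frac{\beta^ip_{k+1}-\alpha^ip_k}{\bar b_i}-\sum_j\bar a_{ij}P_j^k\Big)\Big)\Big].$$ The KKT equations are obtained by setting to zero the derivatives of $\mathcal{L}_d$ with respect to all $q_k,p_k$ ($0\le k\le N$) and $Q_i^k,P_i^k,U_i^k$; the dualization consists of these equations together with the constraints. The transformed multipliers are $\Gamma_i^k=\Lambda_i^k/\bar b_i$, $\chi_i^k=\Psi_i^k/\bar b_i$, $\psi_k=\sum_i\alpha^i\chi_i^k$ for $0\le k\le N-1$ and $\psi_N=\sum_i\beta^i\chi_i^{N-1}$ (the KKT equations give $\sum_i\alpha^i\chi_i^k=\sum_i\beta^i\chi_i^{k-1}$ for $1\le k\le N-1$), with $\mu_k=\lambda_k$. All sums over $j$ run from $1$ to $s$.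
   Formalization: Adds that the second u-derivative of H exists and is jointly continuous for u in the interior of U, as without it (4) need not determine u(q,p,λ,ψ); Q is read as open in R^n, and u as any solution branch of the stationarity condition, with local existence shown a.e. along the optimum. *)

theory Defs
  imports "HOL-Analysis.Analysis"
begin

section \<open>Derivatives and function spaces\<close>

definition grad :: "('a::real_inner \<Rightarrow> real) \<Rightarrow> 'a \<Rightarrow> 'a" where
  "grad \<phi> x = (THE D. GDERIV \<phi> x :> D)"

definition hess :: "(real^'k \<Rightarrow> real) \<Rightarrow> real^'k \<Rightarrow> real^'k^'k" where
  "hess \<phi> x = jacobian (grad \<phi>) (at x)"

definition sym_pos_def :: "real^'k^'k \<Rightarrow> bool" where
  "sym_pos_def A \<longleftrightarrow> transpose A = A \<and> (\<forall>v. v \<noteq> 0 \<longrightarrow> 0 < v \<bullet> (A *v v))"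

text \<open>Class \<open>C\<^sup>k\<close> on an open set, through iterated directional derivatives.\<close>

primrec Ck_on :: "nat \<Rightarrow> ('a::euclidean_space \<Rightarrow> 'b::real_normed_vector) \<Rightarrow> 'a set \<Rightarrow> bool" where
  "Ck_on 0 \<phi> S \<longleftrightarrow> continuous_on S \<phi>"
| "Ck_on (Suc k) \<phi> S \<longleftrightarrow>
     (\<forall>x\<in>S. \<phi> differentiable (at x)) \<and>
     (\<forall>v. Ck_on k (\<lambda>x. frechet_derivative \<phi> (at x) v) S)"

definition Linf :: "real \<Rightarrow> (real \<Rightarrow> 'a::euclidean_space) \<Rightarrow> bool" where
  "Linf T x \<longleftrightarrow> x \<in> borel_measurable (lebesgue_on {0..T}) \<and>
     (\<exists>K. AE t in lebesgue_on {0..T}. norm (x t) \<le> K)"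

text \<open>
  \<open>x\<close> is the (absolutely continuous) representative of a function whose weak derivative on
  \<open>[0,T]\<close> is \<open>y\<close>.
\<close>

definition weak_derivative :: "real \<Rightarrow> (real \<Rightarrow> 'a::euclidean_space) \<Rightarrow> (real \<Rightarrow> 'a) \<Rightarrow> bool" where
  "weak_derivative T x y \<longleftrightarrow> (\<forall>t\<in>{0..T}. (y has_integral (x t - x 0)) {0..t})"

definition W1inf :: "real \<Rightarrow> (real \<Rightarrow> 'a::euclidean_space) \<Rightarrow> bool" where
  "W1inf T x \<longleftrightarrow> (\<exists>y. Linf T y \<and> weak_derivative T x y)"

definition W2inf :: "real \<Rightarrow> (real \<Rightarrow> 'a::euclidean_space) \<Rightarrow> bool" where
  "W2inf T x \<longleftrightarrow> (\<exists>y. W1inf T y \<and> weak_derivative T x y)"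

section \<open>The optimal control problem\<close>

text \<open>
  The configuration manifold is an open set \<open>Q\<close> of \<open>\<real>\<^sup>n\<close>, so that \<open>TQ\<close> and \<open>T\<^sup>*Q\<close> are both
  \<open>Q \<times> \<real>\<^sup>n\<close>; covectors are elements of \<open>\<real>\<^sup>n\<close>, paired by the inner product, and
  covector times Jacobian is \<^const>\<open>vector_matrix_mult\<close>.  The field \<open>force\<close> is the fibre
  component of the control force.  The field \<open>vel\<close> is the map \<open>f\<close>, the inverse of the
  Legendre transform (see \<open>legendre_inverse\<close> below).
\<close>

record ('n, 'm) ocp =
  conf :: "(real^'n) set"
  ctrl :: "(real^'m) set"
  lagr :: "real^'n \<Rightarrow> real^'n \<Rightarrow> real"
  force :: "real^'n \<Rightarrow> real^'n \<Rightarrow> real^'m \<Rightarrow> real^'n"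
  vel :: "real^'n \<Rightarrow> real^'n \<Rightarrow> real^'n"
  cost :: "real^'n \<Rightarrow> real^'n \<Rightarrow> real^'m \<Rightarrow> real"
  final_cost :: "real^'n \<Rightarrow> real^'n \<Rightarrow> real"
  horizon :: real
  q_init :: "real^'n"
  p_init :: "real^'n"

text \<open>The map \<open>g\<close>.\<close>

definition mom :: "('n::finite, 'm::finite) ocp \<Rightarrow> real^'n \<Rightarrow> real^'n \<Rightarrow> real^'m \<Rightarrow> real^'n" where
  "mom M q p u = grad (\<lambda>q'. lagr M q' (vel M q p)) q + force M q (vel M q p) u"

definition regular_lagrangian :: "('n::finite, 'm::finite) ocp \<Rightarrow> bool" where
  "regular_lagrangian M \<longleftrightarrow> (\<forall>q\<in>conf M. \<forall>v.
     lagr M q differentiable (at v) \<and> grad (lagr M q) differentiable (at v) \<and>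
     invertible (hess (lagr M q) v))"

text \<open>
  \<open>f(q,\<sqdot>)\<close> inverts the Legendre transform \<open>v \<mapsto> \<partial>L/\<partial>v(q,v)\<close>, possibly only locally: it is a
  right inverse, and a left inverse near each of its values.
\<close>

definition legendre_inverse :: "('n::finite, 'm::finite) ocp \<Rightarrow> bool" where
  "legendre_inverse M \<longleftrightarrow> (\<forall>q\<in>conf M. \<forall>p.
     grad (lagr M q) (vel M q p) = p \<and>
     (\<forall>\<^sub>F v in nhds (vel M q p). vel M q (grad (lagr M q) v) = v))"

definition hamiltonian ::
  "('n::finite, 'm::finite) ocp \<Rightarrow>
   real^'n \<Rightarrow> real^'n \<Rightarrow> real^'m \<Rightarrow> real^'n \<Rightarrow> real^'n \<Rightarrow> real \<Rightarrow> real" where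
  "hamiltonian M q p u lam \<psi> \<rho>0 =
     \<rho>0 * cost M q p u + lam \<bullet> vel M q p + \<psi> \<bullet> mom M q p u"

text \<open>
  Standing assumptions.  Derivatives with respect to \<open>u\<close> are only taken at interior points
  of the control set.  The last two conjuncts are the regularity needed to speak of
  \<open>\<partial>\<^sup>2H/\<partial>u\<^sup>2\<close> and to solve \<open>\<partial>H/\<partial>u = 0\<close> for \<open>u\<close>.
\<close>

definition standing_assumptions :: "('n::finite, 'm::finite) ocp \<Rightarrow> bool" where
  "standing_assumptions M \<longleftrightarrow>
     0 < horizon M \<and> open (conf M) \<and> q_init M \<in> conf M \<and>
     closed (ctrl M) \<and> convex (ctrl M) \<and>
     (\<forall>q\<in>conf M. \<forall>v. (\<lambda>(q', v'). lagr M q' v') differentiable (at (q, v))) \<and>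
     legendre_inverse M \<and>
     (\<exists>K. K-lipschitz_on (conf M \<times> UNIV) (\<lambda>(q, p). vel M q p)) \<and>
     (\<exists>K. K-lipschitz_on (conf M \<times> UNIV \<times> ctrl M) (\<lambda>(q, p, u). mom M q p u)) \<and>
     (\<forall>q\<in>conf M. \<forall>p. (\<lambda>(q', p'). vel M q' p') differentiable (at (q, p))) \<and>
     (\<forall>q\<in>conf M. \<forall>p. \<forall>u\<in>interior (ctrl M).
        (\<lambda>(q', p', u'). mom M q' p' u') differentiable (at (q, p, u))) \<and>
     continuous_on (conf M \<times> UNIV \<times> ctrl M) (\<lambda>(q, p, u). cost M q p u) \<and>
     Ck_on 1 (\<lambda>(q, p, u). cost M q p u) (conf M \<times> UNIV \<times> interior (ctrl M)) \<and>
     Ck_on 1 (\<lambda>(q, p). final_cost M q p) (conf M \<times> UNIV) \<and>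
     (\<exists>B. \<forall>q\<in>conf M. \<forall>p. B \<le> final_cost M q p) \<and>
     (\<forall>q\<in>conf M. \<forall>p lam \<psi>. \<forall>u\<in>interior (ctrl M).
        grad (\<lambda>v. hamiltonian M q p v lam \<psi> 1) differentiable (at u)) \<and>
     continuous_on (conf M \<times> UNIV \<times> UNIV \<times> UNIV \<times> interior (ctrl M))
       (\<lambda>(q, p, lam, \<psi>, u). hess (\<lambda>v. hamiltonian M q p v lam \<psi> 1) u)"

definition uniformly_coercive :: "('n::finite, 'm::finite) ocp \<Rightarrow> bool" where
  "uniformly_coercive M \<longleftrightarrow> (\<exists>\<alpha>>0. \<forall>q\<in>conf M. \<forall>p.
     ereal \<alpha> \<le> Liminf (inf at_infinity (principal (ctrl M)))
                  (\<lambda>u. ereal (cost M q p u / (norm u)\<^sup>2)))"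

definition cost_smooth_in_state :: "('n::finite, 'm::finite) ocp \<Rightarrow> bool" where
  "cost_smooth_in_state M \<longleftrightarrow>
     (\<forall>u\<in>ctrl M. \<forall>k. Ck_on k (\<lambda>(q, p). cost M q p u) (conf M \<times> UNIV))"

text \<open>Processes satisfying all constraints of the optimal control problem.\<close>

definition admissible ::
  "('n::finite, 'm::finite) ocp \<Rightarrow> (real \<Rightarrow> real^'n) \<Rightarrow> (real \<Rightarrow> real^'n) \<Rightarrow> (real \<Rightarrow> real^'m) \<Rightarrow> bool"
where
  "admissible M q p u \<longleftrightarrow>
     W2inf (horizon M) q \<and> W1inf (horizon M) p \<and> Linf (horizon M) u \<and>
     (\<forall>t\<in>{0..horizon M}. q t \<in> conf M) \<and>
     (AE t in lebesgue_on {0..horizon M}. u t \<in> ctrl M) \<and>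
     q 0 = q_init M \<and> p 0 = p_init M \<and>
     (AE t in lebesgue_on {0..horizon M}.
        (q has_vector_derivative vel M (q t) (p t)) (at t) \<and>
        (p has_vector_derivative mom M (q t) (p t) (u t)) (at t))"

definition objective ::
  "('n::finite, 'm::finite) ocp \<Rightarrow> (real \<Rightarrow> real^'n) \<Rightarrow> (real \<Rightarrow> real^'n) \<Rightarrow> (real \<Rightarrow> real^'m) \<Rightarrow> real"
where
  "objective M q p u =
     integral {0..horizon M} (\<lambda>t. cost M (q t) (p t) (u t)) +
     final_cost M (q (horizon M)) (p (horizon M))"

definition ocp_solution ::
  "('n::finite, 'm::finite) ocp \<Rightarrow> (real \<Rightarrow> real^'n) \<Rightarrow> (real \<Rightarrow> real^'n) \<Rightarrow> (real \<Rightarrow> real^'m) \<Rightarrow> bool"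
where
  "ocp_solution M q p u \<longleftrightarrow> admissible M q p u \<and>
     (\<forall>q' p' u'. admissible M q' p' u' \<longrightarrow> objective M q p u \<le> objective M q' p' u')"

definition unique_ocp_solution ::
  "('n::finite, 'm::finite) ocp \<Rightarrow> (real \<Rightarrow> real^'n) \<Rightarrow> (real \<Rightarrow> real^'n) \<Rightarrow> (real \<Rightarrow> real^'m) \<Rightarrow> bool"
where
  "unique_ocp_solution M q p u \<longleftrightarrow> ocp_solution M q p u \<and>
     (\<forall>q' p' u'. ocp_solution M q' p' u' \<longrightarrow>
        (\<forall>t\<in>{0..horizon M}. q' t = q t \<and> p' t = p t) \<and>
        (AE t in lebesgue_on {0..horizon M}. u' t = u t))"

text \<open>The condition \<open>0 = \<nabla>\<^sub>u C + \<psi> \<sqdot> \<nabla>\<^sub>u g\<close>.\<close>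

definition stationary ::
  "('n::finite, 'm::finite) ocp \<Rightarrow> real^'n \<Rightarrow> real^'n \<Rightarrow> real^'n \<Rightarrow> real^'m \<Rightarrow> bool" where
  "stationary M q p \<psi> u \<longleftrightarrow>
     0 = grad (cost M q p) u + \<psi> v* jacobian (mom M q p) (at u)"

text \<open>The necessary optimality conditions, in normal form.\<close>

definition adjoint_variables ::
  "('n::finite, 'm::finite) ocp \<Rightarrow> (real \<Rightarrow> real^'n) \<Rightarrow> (real \<Rightarrow> real^'n) \<Rightarrow> (real \<Rightarrow> real^'m) \<Rightarrow>
   (real \<Rightarrow> real^'n) \<Rightarrow> (real \<Rightarrow> real^'n) \<Rightarrow> bool"
where
  "adjoint_variables M q p u lam \<psi> \<longleftrightarrow>
     W1inf (horizon M) lam \<and> W1inf (horizon M) \<psi> \<and>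
     (AE t in lebesgue_on {0..horizon M}.
        (lam has_vector_derivative
           - grad (\<lambda>x. hamiltonian M x (p t) (u t) (lam t) (\<psi> t) 1) (q t)) (at t) \<and>
        (\<psi> has_vector_derivative
           - grad (\<lambda>y. hamiltonian M (q t) y (u t) (lam t) (\<psi> t) 1) (p t)) (at t) \<and>
        stationary M (q t) (p t) (\<psi> t) (u t)) \<and>
     lam (horizon M) = grad (\<lambda>x. final_cost M x (p (horizon M))) (q (horizon M)) \<and>
     \<psi> (horizon M) = grad (\<lambda>y. final_cost M (q (horizon M)) y) (p (horizon M))"

text \<open>
  A function \<open>u(q,p,\<lambda>,\<psi>)\<close> obtained by solving the stationarity condition for the control.
  In general the equation has a unique solution only on a given branch: \<open>\<Omega>\<close> consists of
  pairs \<open>((q,p,\<lambda>,\<psi>), v)\<close>, and within \<open>\<Omega>\<close> the stationary points form the graph of \<open>u\<close>.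
\<close>

type_synonym 'n ext_state = "(real^'n) \<times> (real^'n) \<times> (real^'n) \<times> (real^'n)"

definition control_law ::
  "('n::finite, 'm::finite) ocp \<Rightarrow> ('n ext_state \<times> (real^'m)) set \<Rightarrow> ('n ext_state \<Rightarrow> real^'m) \<Rightarrow> bool"
where
  "control_law M \<Omega> u \<longleftrightarrow>
     \<Omega> \<subseteq> (conf M \<times> UNIV \<times> UNIV \<times> UNIV) \<times> interior (ctrl M) \<and>
     (\<forall>w\<in>Domain \<Omega>. (w, u w) \<in> \<Omega>) \<and>
     (\<forall>q p lam \<psi> v. ((q, p, lam, \<psi>), v) \<in> \<Omega> \<longrightarrow>
        (stationary M q p \<psi> v \<longleftrightarrow> v = u (q, p, lam, \<psi>)))"

text \<open>The right-hand sides \<open>g(q,p,\<lambda>,\<psi>)\<close>, \<open>\<nu>\<close> and \<open>\<eta>\<close> of the boundary value problem.\<close>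

definition mom_law ::
  "('n::finite, 'm::finite) ocp \<Rightarrow> ('n ext_state \<Rightarrow> real^'m) \<Rightarrow>
   real^'n \<Rightarrow> real^'n \<Rightarrow> real^'n \<Rightarrow> real^'n \<Rightarrow> real^'n" where
  "mom_law M u q p lam \<psi> = mom M q p (u (q, p, lam, \<psi>))"

definition nu ::
  "('n::finite, 'm::finite) ocp \<Rightarrow> ('n ext_state \<Rightarrow> real^'m) \<Rightarrow>
   real^'n \<Rightarrow> real^'n \<Rightarrow> real^'n \<Rightarrow> real^'n \<Rightarrow> real^'n" where
  "nu M u q p lam \<psi> = (let v = u (q, p, lam, \<psi>) in
     - grad (\<lambda>x. cost M x p v) q
     - lam v* jacobian (\<lambda>x. vel M x p) (at q)
     - \<psi> v* jacobian (\<lambda>x. mom M x p v) (at q))"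

definition eta ::
  "('n::finite, 'm::finite) ocp \<Rightarrow> ('n ext_state \<Rightarrow> real^'m) \<Rightarrow>
   real^'n \<Rightarrow> real^'n \<Rightarrow> real^'n \<Rightarrow> real^'n \<Rightarrow> real^'n" where
  "eta M u q p lam \<psi> = (let v = u (q, p, lam, \<psi>) in
     - grad (\<lambda>y. cost M q y v) p
     - lam v* jacobian (\<lambda>y. vel M q y) (at p)
     - \<psi> v* jacobian (\<lambda>y. mom M q y v) (at p))"

section \<open>Symplectic Galerkin discretization\<close>

definition collocation_points :: "nat \<Rightarrow> (nat \<Rightarrow> real) \<Rightarrow> bool" where
  "collocation_points s c \<longleftrightarrow>
     1 \<le> s \<and> strict_mono_on {1..s} c \<and> (\<forall>i\<in>{1..s}. 0 \<le> c i \<and> c i \<le> 1)"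

definition lagrange_poly :: "nat \<Rightarrow> (nat \<Rightarrow> real) \<Rightarrow> nat \<Rightarrow> real \<Rightarrow> real" where
  "lagrange_poly s c j t = (\<Prod>i\<in>{1..s} - {j}. (t - c i) / (c j - c i))"

definition sg_b :: "nat \<Rightarrow> (nat \<Rightarrow> real) \<Rightarrow> nat \<Rightarrow> real" where
  "sg_b s c j = integral {0..1} (lagrange_poly s c j)"

abbreviation sg_bbar :: "nat \<Rightarrow> (nat \<Rightarrow> real) \<Rightarrow> nat \<Rightarrow> real" where
  "sg_bbar \<equiv> sg_b"

definition sg_a :: "nat \<Rightarrow> (nat \<Rightarrow> real) \<Rightarrow> nat \<Rightarrow> nat \<Rightarrow> real" where
  "sg_a s c i j = deriv (lagrange_poly s c j) (c i)"

definition sg_alpha :: "nat \<Rightarrow> (nat \<Rightarrow> real) \<Rightarrow> nat \<Rightarrow> real" where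
  "sg_alpha s c j = lagrange_poly s c j 0"

definition sg_beta :: "nat \<Rightarrow> (nat \<Rightarrow> real) \<Rightarrow> nat \<Rightarrow> real" where
  "sg_beta s c j = lagrange_poly s c j 1"

text \<open>The solution of \<open>b\<^sub>j a\<^sub>j\<^sub>i + b'\<^sub>i a'\<^sub>i\<^sub>j = 0\<close> (primes for bars), for \<open>b'\<^sub>i \<noteq> 0\<close>.\<close>

definition sg_abar :: "nat \<Rightarrow> (nat \<Rightarrow> real) \<Rightarrow> nat \<Rightarrow> nat \<Rightarrow> real" where
  "sg_abar s c i j = - (sg_b s c j * sg_a s c j i) / sg_bbar s c i"

definition step_size :: "('n::finite, 'm::finite) ocp \<Rightarrow> nat \<Rightarrow> real" where
  "step_size M N = horizon M / real N"

text \<open>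
  The constraints of the discrete problem: node values \<open>q k, p k\<close> for \<open>k \<le> N\<close> and stage
  values \<open>Q k i, P k i, U k i\<close> for \<open>k < N\<close>, \<open>1 \<le> i \<le> s\<close>.
\<close>

definition sg_constraints ::
  "('n::finite, 'm::finite) ocp \<Rightarrow> nat \<Rightarrow> (nat \<Rightarrow> real) \<Rightarrow> nat \<Rightarrow>
   (nat \<Rightarrow> real^'n) \<Rightarrow> (nat \<Rightarrow> real^'n) \<Rightarrow>
   (nat \<Rightarrow> nat \<Rightarrow> real^'n) \<Rightarrow> (nat \<Rightarrow> nat \<Rightarrow> real^'n) \<Rightarrow> (nat \<Rightarrow> nat \<Rightarrow> real^'m) \<Rightarrow> bool"
where
  "sg_constraints M s c N q p Q P U \<longleftrightarrow>
     (\<forall>k\<le>N. q k \<in> conf M) \<and>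
     (\<forall>k<N. \<forall>i\<in>{1..s}. Q k i \<in> conf M \<and> U k i \<in> ctrl M) \<and>
     q 0 = q_init M \<and> p 0 = p_init M \<and>
     (\<forall>k<N.
        q k = (\<Sum>j=1..s. sg_alpha s c j *\<^sub>R Q k j) \<and>
        q (Suc k) = (\<Sum>j=1..s. sg_beta s c j *\<^sub>R Q k j) \<and>
        (\<forall>i\<in>{1..s}.
           vel M (Q k i) (P k i) =
             (1 / step_size M N) *\<^sub>R (\<Sum>j=1..s. sg_a s c i j *\<^sub>R Q k j) \<and>
           mom M (Q k i) (P k i) (U k i) =
             (1 / (step_size M N * sg_bbar s c i)) *\<^sub>R
               (sg_beta s c i *\<^sub>R p (Suc k) - sg_alpha s c i *\<^sub>R p k) +
             (1 / step_size M N) *\<^sub>R (\<Sum>j=1..s. sg_abar s c i j *\<^sub>R P k j)))"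

text \<open>
  For every fixed continuous control whose exact trajectory exists on the whole interval,
  discrete trajectories exist for small steps, and they converge uniformly at the nodes.
\<close>

definition convergent_sg ::
  "('n::finite, 'm::finite) ocp \<Rightarrow> nat \<Rightarrow> (nat \<Rightarrow> real) \<Rightarrow> bool" where
  "convergent_sg M s c \<longleftrightarrow>
     (\<forall>q p u. continuous_on {0..horizon M} u \<and> u ` {0..horizon M} \<subseteq> ctrl M \<and>
              admissible M q p u \<longrightarrow>
        (\<forall>\<epsilon>>0. \<forall>\<^sub>F N in sequentially.
           let t = (\<lambda>k. real k * step_size M N);
               U = (\<lambda>k i. u (t k + c i * step_size M N))
           in (\<exists>q' p' Q P. sg_constraints M s c N q' p' Q P U) \<and>
              (\<forall>q' p' Q P. sg_constraints M s c N q' p' Q P U \<longrightarrow>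
                 (\<forall>k\<le>N. norm (q' k - q (t k)) < \<epsilon> \<and> norm (p' k - p (t k)) < \<epsilon>))))"

definition discrete_lagrangian ::
  "('n::finite, 'm::finite) ocp \<Rightarrow> nat \<Rightarrow> (nat \<Rightarrow> real) \<Rightarrow> nat \<Rightarrow>
   (nat \<Rightarrow> real^'n) \<Rightarrow> (nat \<Rightarrow> real^'n) \<Rightarrow>
   (nat \<Rightarrow> nat \<Rightarrow> real^'n) \<Rightarrow> (nat \<Rightarrow> nat \<Rightarrow> real^'n) \<Rightarrow> (nat \<Rightarrow> nat \<Rightarrow> real^'m) \<Rightarrow>
   (nat \<Rightarrow> real^'n) \<Rightarrow> (nat \<Rightarrow> real^'n) \<Rightarrow> real^'n \<Rightarrow>
   (nat \<Rightarrow> nat \<Rightarrow> real^'n) \<Rightarrow> (nat \<Rightarrow> nat \<Rightarrow> real^'n) \<Rightarrow> real"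
where
  "discrete_lagrangian M s c N q p Q P U lam \<mu> \<psi>0 \<Lambda> \<Psi> =
     (\<Sum>k<N. \<Sum>i=1..s. step_size M N * sg_b s c i * cost M (Q k i) (P k i) (U k i)) +
     final_cost M (q N) (p N)
     - lam 0 \<bullet> (q 0 - q_init M) - \<psi>0 \<bullet> (p 0 - p_init M) +
     (\<Sum>k<N.
        \<mu> k \<bullet> (q k - (\<Sum>j=1..s. sg_alpha s c j *\<^sub>R Q k j))
        - lam (Suc k) \<bullet> (q (Suc k) - (\<Sum>j=1..s. sg_beta s c j *\<^sub>R Q k j)) +
        (\<Sum>i=1..s.
           \<Lambda> k i \<bullet> (step_size M N *\<^sub>R vel M (Q k i) (P k i) -
                     (\<Sum>j=1..s. sg_a s c i j *\<^sub>R Q k j)) +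
           \<Psi> k i \<bullet> (step_size M N *\<^sub>R mom M (Q k i) (P k i) (U k i) -
                     (1 / sg_bbar s c i) *\<^sub>R
                       (sg_beta s c i *\<^sub>R p (Suc k) - sg_alpha s c i *\<^sub>R p k) -
                     (\<Sum>j=1..s. sg_abar s c i j *\<^sub>R P k j))))"

text \<open>All partial gradients with respect to the primal variables exist and vanish.\<close>

definition kkt ::
  "('n::finite, 'm::finite) ocp \<Rightarrow> nat \<Rightarrow> (nat \<Rightarrow> real) \<Rightarrow> nat \<Rightarrow>
   (nat \<Rightarrow> real^'n) \<Rightarrow> (nat \<Rightarrow> real^'n) \<Rightarrow>
   (nat \<Rightarrow> nat \<Rightarrow> real^'n) \<Rightarrow> (nat \<Rightarrow> nat \<Rightarrow> real^'n) \<Rightarrow> (nat \<Rightarrow> nat \<Rightarrow> real^'m) \<Rightarrow>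
   (nat \<Rightarrow> real^'n) \<Rightarrow> (nat \<Rightarrow> real^'n) \<Rightarrow> real^'n \<Rightarrow>
   (nat \<Rightarrow> nat \<Rightarrow> real^'n) \<Rightarrow> (nat \<Rightarrow> nat \<Rightarrow> real^'n) \<Rightarrow> bool"
where
  "kkt M s c N q p Q P U lam \<mu> \<psi>0 \<Lambda> \<Psi> \<longleftrightarrow>
     (\<forall>k\<le>N.
        GDERIV (\<lambda>x. discrete_lagrangian M s c N (q(k := x)) p Q P U lam \<mu> \<psi>0 \<Lambda> \<Psi>) (q k) :> 0 \<and>
        GDERIV (\<lambda>x. discrete_lagrangian M s c N q (p(k := x)) Q P U lam \<mu> \<psi>0 \<Lambda> \<Psi>) (p k) :> 0) \<and>
     (\<forall>k<N. \<forall>i\<in>{1..s}.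
        GDERIV (\<lambda>x. discrete_lagrangian M s c N q p (Q(k := (Q k)(i := x))) P U lam \<mu> \<psi>0 \<Lambda> \<Psi>)
          (Q k i) :> 0 \<and>
        GDERIV (\<lambda>x. discrete_lagrangian M s c N q p Q (P(k := (P k)(i := x))) U lam \<mu> \<psi>0 \<Lambda> \<Psi>)
          (P k i) :> 0 \<and>
        GDERIV (\<lambda>x. discrete_lagrangian M s c N q p Q P (U(k := (U k)(i := x))) lam \<mu> \<psi>0 \<Lambda> \<Psi>)
          (U k i) :> 0)"

definition discrete_dualization ::
  "('n::finite, 'm::finite) ocp \<Rightarrow> nat \<Rightarrow> (nat \<Rightarrow> real) \<Rightarrow> nat \<Rightarrow>
   (nat \<Rightarrow> real^'n) \<Rightarrow> (nat \<Rightarrow> real^'n) \<Rightarrow>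
   (nat \<Rightarrow> nat \<Rightarrow> real^'n) \<Rightarrow> (nat \<Rightarrow> nat \<Rightarrow> real^'n) \<Rightarrow> (nat \<Rightarrow> nat \<Rightarrow> real^'m) \<Rightarrow>
   (nat \<Rightarrow> real^'n) \<Rightarrow> (nat \<Rightarrow> real^'n) \<Rightarrow> real^'n \<Rightarrow>
   (nat \<Rightarrow> nat \<Rightarrow> real^'n) \<Rightarrow> (nat \<Rightarrow> nat \<Rightarrow> real^'n) \<Rightarrow> bool"
where
  "discrete_dualization M s c N q p Q P U lam \<mu> \<psi>0 \<Lambda> \<Psi> \<longleftrightarrow>
     sg_constraints M s c N q p Q P U \<and> kkt M s c N q p Q P U lam \<mu> \<psi>0 \<Lambda> \<Psi>"

definition stage_multipliers ::
  "nat \<Rightarrow> (nat \<Rightarrow> real) \<Rightarrow> nat \<Rightarrow>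
   (nat \<Rightarrow> nat \<Rightarrow> real^'n) \<Rightarrow> (nat \<Rightarrow> nat \<Rightarrow> real^'n) \<Rightarrow>
   (nat \<Rightarrow> nat \<Rightarrow> real^'n) \<Rightarrow> (nat \<Rightarrow> nat \<Rightarrow> real^'n) \<Rightarrow> bool"
where
  "stage_multipliers s c N \<Lambda> \<Psi> \<Gamma> chi \<longleftrightarrow>
     (\<forall>k<N. \<forall>i\<in>{1..s}.
        \<Gamma> k i = (1 / sg_bbar s c i) *\<^sub>R \<Lambda> k i \<and> chi k i = (1 / sg_bbar s c i) *\<^sub>R \<Psi> k i)"

definition node_multipliers ::
  "nat \<Rightarrow> (nat \<Rightarrow> real) \<Rightarrow> nat \<Rightarrow> (nat \<Rightarrow> nat \<Rightarrow> real^'n) \<Rightarrow> (nat \<Rightarrow> real^'n) \<Rightarrow> bool"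
where
  "node_multipliers s c N chi \<psi> \<longleftrightarrow>
     (\<forall>k<N. \<psi> k = (\<Sum>i=1..s. sg_alpha s c i *\<^sub>R chi k i)) \<and>
     \<psi> N = (\<Sum>i=1..s. sg_beta s c i *\<^sub>R chi (N - 1) i)"

text \<open>
  The sG discretization of the boundary value problem, in which \<open>(q,\<psi>)\<close> are discretized
  as \<open>q\<close> is in the state equations, and \<open>(p,\<lambda>)\<close> as \<open>p\<close> is.
\<close>

definition sg_bvp ::
  "('n::finite, 'm::finite) ocp \<Rightarrow> ('n ext_state \<Rightarrow> real^'m) \<Rightarrow> nat \<Rightarrow> (nat \<Rightarrow> real) \<Rightarrow> nat \<Rightarrow>
   (nat \<Rightarrow> real^'n) \<Rightarrow> (nat \<Rightarrow> real^'n) \<Rightarrow> (nat \<Rightarrow> real^'n) \<Rightarrow> (nat \<Rightarrow> real^'n) \<Rightarrow>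
   (nat \<Rightarrow> nat \<Rightarrow> real^'n) \<Rightarrow> (nat \<Rightarrow> nat \<Rightarrow> real^'n) \<Rightarrow>
   (nat \<Rightarrow> nat \<Rightarrow> real^'n) \<Rightarrow> (nat \<Rightarrow> nat \<Rightarrow> real^'n) \<Rightarrow> bool"
where
  "sg_bvp M u s c N q p lam \<psi> Q P \<Gamma> chi \<longleftrightarrow>
     (\<forall>k\<le>N. q k \<in> conf M) \<and>
     (\<forall>k<N. \<forall>i\<in>{1..s}. Q k i \<in> conf M) \<and>
     (\<forall>k<N.
        q k = (\<Sum>j=1..s. sg_alpha s c j *\<^sub>R Q k j) \<and>
        q (Suc k) = (\<Sum>j=1..s. sg_beta s c j *\<^sub>R Q k j) \<and>
        \<psi> k = (\<Sum>j=1..s. sg_alpha s c j *\<^sub>R chi k j) \<and>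
        \<psi> (Suc k) = (\<Sum>j=1..s. sg_beta s c j *\<^sub>R chi k j) \<and>
        (\<forall>i\<in>{1..s}.
           vel M (Q k i) (P k i) =
             (1 / step_size M N) *\<^sub>R (\<Sum>j=1..s. sg_a s c i j *\<^sub>R Q k j) \<and>
           mom_law M u (Q k i) (P k i) (\<Gamma> k i) (chi k i) =
             (1 / (step_size M N * sg_bbar s c i)) *\<^sub>R
               (sg_beta s c i *\<^sub>R p (Suc k) - sg_alpha s c i *\<^sub>R p k) +
             (1 / step_size M N) *\<^sub>R (\<Sum>j=1..s. sg_abar s c i j *\<^sub>R P k j) \<and>
           eta M u (Q k i) (P k i) (\<Gamma> k i) (chi k i) =
             (1 / step_size M N) *\<^sub>R (\<Sum>j=1..s. sg_a s c i j *\<^sub>R chi k j) \<and>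
           nu M u (Q k i) (P k i) (\<Gamma> k i) (chi k i) =
             (1 / (step_size M N * sg_bbar s c i)) *\<^sub>R
               (sg_beta s c i *\<^sub>R lam (Suc k) - sg_alpha s c i *\<^sub>R lam k) +
             (1 / step_size M N) *\<^sub>R (\<Sum>j=1..s. sg_abar s c i j *\<^sub>R \<Gamma> k j))) \<and>
     q 0 = q_init M \<and> p 0 = p_init M \<and>
     lam N = grad (\<lambda>x. final_cost M x (p N)) (q N) \<and>
     \<psi> N = grad (\<lambda>y. final_cost M (q N) y) (p N)"

end

theory Submission
  imports Defs
begin

text \<open>
  Two facts have to be shown: near the optimal solution the stationarity condition can be solved for
  the control, and the KKT system of the discrete problem is the sG discretization of the boundary
  value problem.

  For the first, the stationarity condition says that \<open>u\<close> is a critical point of the Hamiltonian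
  \<open>H(q, p, \<sqdot>, \<lambda>, \<psi>, 1)\<close>.  At almost every time the Hessian with respect to \<open>u\<close> is positive definite at
  the optimal control, and by continuity it stays positive nearby.  So the Hamiltonian is strictly
  convex in \<open>u\<close> on a small ball, uniformly in the parameters \<open>(q, p, \<lambda>, \<psi>)\<close>, and the critical point
  is the unique minimizer on that ball, which depends continuously on the parameters
  (\<open>critical_point_branch\<close>, \<open>control_law_exists\<close>).  This route is taken because the standing
  assumptions give continuity of the Hamiltonian and of its Hessian in all variables, but
  say nothing directly about how its gradient in \<open>u\<close> depends on the parameters.

  For the second, the multipliers are rescaled by the quadrature weights, \<open>\<Lambda> = b\<Gamma>\<close> and
  \<open>\<Psi> = b chi\<close>.  The discrete Lagrangian then is a quadrature sum of Hamiltonians plus terms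
  linear in the unknowns (\<open>discrete_lagrangian_regrouped\<close>).  In the linear terms the coefficient
  matrices \<open>a\<close> and \<open>a'\<close> (prime for bar) appear transposed, and the symplecticity relation
  \<open>b\<^sub>i a\<^sub>i\<^sub>j + b'\<^sub>j a'\<^sub>j\<^sub>i = 0\<close> exchanges each transpose for the negative of the other matrix
  (\<open>stage_linear_part\<close>).  The gradient with respect to a stage value \<open>Q\<close> or \<open>P\<close> is therefore
  \<open>h b\<^sub>i\<close> times the gradient of \<open>H\<close>, which is \<open>-\<nu>\<close> or \<open>-\<eta>\<close>, plus the discrete derivative of \<open>\<lambda>\<close> or \<open>\<psi>\<close>;
  the gradient with respect to \<open>U\<close> is \<open>h b\<^sub>i\<close> times the stationarity expression.  The gradients
  with respect to the node values give \<open>\<mu> = \<lambda>\<close>, the continuity of the discrete \<open>\<psi>\<close> across steps, and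
  the terminal conditions.  Since \<open>h b\<^sub>i > 0\<close>, all these equations can be divided by \<open>h b\<^sub>i\<close>, and
  they are then literally those of the discretized boundary value problem
  (\<open>kkt_iff_adjoint_equations\<close>, \<open>discrete_dualization_iff_sg_bvp\<close>).
\<close>

section \<open>Gradients\<close>

lemma GDERIV_unique:
  fixes \<phi> :: "'a::real_inner \<Rightarrow> real"
  assumes "GDERIV \<phi> x :> D" and "GDERIV \<phi> x :> E"
  shows "D = E"
proof -
  have "(\<lambda>h. h \<bullet> D) = (\<lambda>h. h \<bullet> E)"
    using assms unfolding gderiv_def by (rule has_derivative_unique)
  then have "(D - E) \<bullet> D = (D - E) \<bullet> E"
    by meson
  then have "(D - E) \<bullet> (D - E) = 0"
    by (simp add: inner_diff_right)
  then show ?thesis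
    by simp
qed

lemma grad_eqI: "GDERIV \<phi> x :> D \<Longrightarrow> grad \<phi> x = D"
  unfolding grad_def using GDERIV_unique by blast

lemma GDERIV_grad:
  fixes \<phi> :: "'a::euclidean_space \<Rightarrow> real"
  assumes "\<phi> differentiable (at x)"
  shows "GDERIV \<phi> x :> grad \<phi> x"
proof -
  obtain f' where f': "(\<phi> has_derivative f') (at x)"
    using assms unfolding differentiable_def by blast
  then have lin: "linear f'"
    by (rule has_derivative_linear)
  have "f' h = h \<bullet> (\<Sum>b\<in>Basis. f' b *\<^sub>R b)" for h
  proof -
    have "f' h = f' (\<Sum>b\<in>Basis. (h \<bullet> b) *\<^sub>R b)"
      by (simp add: euclidean_representation)
    also have "\<dots> = h \<bullet> (\<Sum>b\<in>Basis. f' b *\<^sub>R b)"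
      by (simp add: linear_sum[OF lin] linear_scale[OF lin] inner_sum_right mult.commute)
    finally show ?thesis .
  qed
  then have "f' = (\<lambda>h. h \<bullet> (\<Sum>b\<in>Basis. f' b *\<^sub>R b))"
    by blast
  then have "GDERIV \<phi> x :> (\<Sum>b\<in>Basis. f' b *\<^sub>R b)"
    using f' unfolding gderiv_def by simp
  then show ?thesis
    using grad_eqI by metis
qed

lemma GDERIV_affine_const: "GDERIV f x :> D \<Longrightarrow> GDERIV (\<lambda>y. f y + (a \<bullet> y + K)) x :> D + a"
proof -
  assume f: "GDERIV f x :> D"
  have "GDERIV (\<lambda>y. a \<bullet> y + K) x :> a"
    unfolding gderiv_def by (auto intro!: derivative_eq_intros simp: inner_commute)
  with f show ?thesis
    by (rule GDERIV_add)
qed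

lemma differentiable_partial3:
  assumes "(\<lambda>(x, y, z). f x y z) differentiable (at (a, b, c))"
  shows "(\<lambda>x. f x b c) differentiable (at a)"
    and "(\<lambda>y. f a y c) differentiable (at b)"
    and "(\<lambda>z. f a b z) differentiable (at c)"
proof -
  obtain D where D: "((\<lambda>(x, y, z). f x y z) has_derivative D) (at (a, b, c))"
    using assms unfolding differentiable_def by blast
  have "((\<lambda>x. (x, b, c)) has_derivative (\<lambda>h. (h, 0, 0))) (at a)"
    and "((\<lambda>y. (a, y, c)) has_derivative (\<lambda>h. (0, h, 0))) (at b)"
    and "((\<lambda>z. (a, b, z)) has_derivative (\<lambda>h. (0, 0, h))) (at c)"
    by (auto intro!: derivative_eq_intros simp: zero_prod_def)
  from this[THEN has_derivative_compose, OF D]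
  have "((\<lambda>x. f x b c) has_derivative (\<lambda>h. D (h, 0, 0))) (at a)"
    and "((\<lambda>y. f a y c) has_derivative (\<lambda>h. D (0, h, 0))) (at b)"
    and "((\<lambda>z. f a b z) has_derivative (\<lambda>h. D (0, 0, h))) (at c)"
    by simp_all
  from this[THEN differentiableI] show "(\<lambda>x. f x b c) differentiable (at a)"
    and "(\<lambda>y. f a y c) differentiable (at b)"
    and "(\<lambda>z. f a b z) differentiable (at c)"
    by simp_all
qed

lemma differentiable_partial2:
  assumes "(\<lambda>(x, y). f x y) differentiable (at (a, b))"
  shows "(\<lambda>x. f x b) differentiable (at a)"
    and "(\<lambda>y. f a y) differentiable (at b)"
proof -
  obtain D where D: "((\<lambda>(x, y). f x y) has_derivative D) (at (a, b))"
    using assms unfolding differentiable_def by blast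
  have "((\<lambda>x. (x, b)) has_derivative (\<lambda>h. (h, 0))) (at a)"
    and "((\<lambda>y. (a, y)) has_derivative (\<lambda>h. (0, h))) (at b)"
    by (auto intro!: derivative_eq_intros simp: zero_prod_def)
  from this[THEN has_derivative_compose, OF D]
  have "((\<lambda>x. f x b) has_derivative (\<lambda>h. D (h, 0))) (at a)"
    and "((\<lambda>y. f a y) has_derivative (\<lambda>h. D (0, h))) (at b)"
    by simp_all
  from this[THEN differentiableI] show "(\<lambda>x. f x b) differentiable (at a)"
    and "(\<lambda>y. f a y) differentiable (at b)"
    by simp_all
qed

lemma GDERIV_inner_jacobian:
  fixes f :: "real^'k \<Rightarrow> real^'l"
  assumes "f differentiable (at x)"
  shows "GDERIV (\<lambda>y. a \<bullet> f y) x :> a v* jacobian f (at x)"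
proof -
  have "(f has_derivative (\<lambda>h. jacobian f (at x) *v h)) (at x)"
    using assms by (simp add: jacobian_works)
  then have "((\<lambda>y. a \<bullet> f y) has_derivative (\<lambda>h. a \<bullet> (jacobian f (at x) *v h))) (at x)"
    by (rule has_derivative_inner_right)
  then show ?thesis
    unfolding gderiv_def by (simp add: dot_lmul_matrix[symmetric] inner_commute)
qed

lemma Ck_on_1_differentiable: "Ck_on 1 \<phi> S \<Longrightarrow> x \<in> S \<Longrightarrow> \<phi> differentiable (at x)"
  by simp

section \<open>Critical points depending on a parameter\<close>

text \<open>
  The function \<open>t \<mapsto> \<nabla>\<phi>(x + t(y - x)) \<bullet> (y - x)\<close> is increasing, since its derivative is the
  Hessian form at \<open>x + t(y - x)\<close> evaluated on \<open>y - x\<close>.  In particular a function with positive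
  Hessian on a convex set has at most one critical point there.
\<close>

lemma grad_strictly_monotone:
  fixes \<phi> :: "real^'k \<Rightarrow> real"
  assumes "convex B" and "x \<in> B" and "y \<in> B" and "x \<noteq> y"
    and diff: "\<And>v. v \<in> B \<Longrightarrow> grad \<phi> differentiable (at v)"
    and pos: "\<And>v d. v \<in> B \<Longrightarrow> d \<noteq> 0 \<Longrightarrow> 0 < d \<bullet> (hess \<phi> v *v d)"
  shows "0 < (grad \<phi> y - grad \<phi> x) \<bullet> (y - x)"
proof -
  define z where "z t = x + t *\<^sub>R (y - x)" for t
  define f where "f t = grad \<phi> (z t) \<bullet> (y - x)" for t
  have zB: "z t \<in> B" if "0 \<le> t" "t \<le> 1" for t
  proof -
    have "z t = (1 - t) *\<^sub>R x + t *\<^sub>R y"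
      by (simp add: z_def algebra_simps)
    then show ?thesis
      using assms(1-3) that by (simp add: convexD)
  qed
  have "f 0 < f 1"
  proof (rule DERIV_pos_imp_increasing[of 0 1 f])
    fix t :: real assume t: "0 \<le> t" "t \<le> 1"
    have "(grad \<phi> has_derivative (\<lambda>h. hess \<phi> (z t) *v h)) (at (z t))"
      using diff[OF zB[OF t]] unfolding hess_def by (simp add: jacobian_works)
    moreover have "(z has_derivative (\<lambda>r. r *\<^sub>R (y - x))) (at t)"
      unfolding z_def by (auto intro!: derivative_eq_intros)
    ultimately have "((\<lambda>t. grad \<phi> (z t)) has_derivative
        (\<lambda>r. hess \<phi> (z t) *v (r *\<^sub>R (y - x)))) (at t)"
      by (rule has_derivative_compose[rotated])
    then have "(f has_derivative (\<lambda>r. (hess \<phi> (z t) *v (r *\<^sub>R (y - x))) \<bullet> (y - x))) (at t)"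
      unfolding f_def by (rule has_derivative_inner_left)
    moreover have "(\<lambda>r. (hess \<phi> (z t) *v (r *\<^sub>R (y - x))) \<bullet> (y - x)) =
        (*) ((y - x) \<bullet> (hess \<phi> (z t) *v (y - x)))"
      by (auto simp: fun_eq_iff matrix_vector_mult_scaleR inner_commute)
    ultimately have "DERIV f t :> (y - x) \<bullet> (hess \<phi> (z t) *v (y - x))"
      unfolding has_field_derivative_def by simp
    then show "\<exists>D. DERIV f t :> D \<and> 0 < D"
      using pos[OF zB[OF t]] \<open>x \<noteq> y\<close> by force
  qed simp
  then show ?thesis
    by (simp add: f_def z_def inner_diff_left)
qed

lemma strict_min_at_critical_point:
  fixes \<phi> :: "real^'k \<Rightarrow> real"
  assumes "convex B" and "x \<in> B" and "y \<in> B" and "x \<noteq> y"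
    and diff: "\<And>v. v \<in> B \<Longrightarrow> \<phi> differentiable (at v)"
    and diff2: "\<And>v. v \<in> B \<Longrightarrow> grad \<phi> differentiable (at v)"
    and pos: "\<And>v d. v \<in> B \<Longrightarrow> d \<noteq> 0 \<Longrightarrow> 0 < d \<bullet> (hess \<phi> v *v d)"
    and crit: "grad \<phi> x = 0"
  shows "\<phi> x < \<phi> y"
proof -
  define z where "z t = x + t *\<^sub>R (y - x)" for t
  have zB: "z t \<in> B" if "0 \<le> t" "t \<le> 1" for t
  proof -
    have "z t = (1 - t) *\<^sub>R x + t *\<^sub>R y"
      by (simp add: z_def algebra_simps)
    then show ?thesis
      using assms(1-3) that by (simp add: convexD)
  qed
  have D: "((\<lambda>t. \<phi> (z t)) has_real_derivative (grad \<phi> (z t) \<bullet> (y - x))) (at t)"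
    if t: "0 \<le> t" "t \<le> 1" for t
  proof -
    have "(\<phi> has_derivative (\<lambda>h. h \<bullet> grad \<phi> (z t))) (at (z t))"
      using GDERIV_grad[OF diff[OF zB[OF t]]] unfolding gderiv_def .
    moreover have "(z has_derivative (\<lambda>r. r *\<^sub>R (y - x))) (at t)"
      unfolding z_def by (auto intro!: derivative_eq_intros)
    ultimately have "((\<lambda>t. \<phi> (z t)) has_derivative (\<lambda>r. (r *\<^sub>R (y - x)) \<bullet> grad \<phi> (z t))) (at t)"
      by (rule has_derivative_compose[rotated])
    moreover have "(\<lambda>r. (r *\<^sub>R (y - x)) \<bullet> grad \<phi> (z t)) = (*) (grad \<phi> (z t) \<bullet> (y - x))"
      by (auto simp: fun_eq_iff inner_commute)
    ultimately show ?thesis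
      unfolding has_field_derivative_def by simp
  qed
  obtain t where t: "0 < t" "t < 1" and eq: "\<phi> (z 1) - \<phi> (z 0) = (1 - 0) * (grad \<phi> (z t) \<bullet> (y - x))"
    using MVT2[of 0 1 "\<lambda>t. \<phi> (z t)" "\<lambda>t. grad \<phi> (z t) \<bullet> (y - x)"] D by auto
  have "x \<noteq> z t"
    using t \<open>x \<noteq> y\<close> by (simp add: z_def)
  then have "0 < (grad \<phi> (z t) - grad \<phi> x) \<bullet> (z t - x)"
    using grad_strictly_monotone[OF \<open>convex B\<close> \<open>x \<in> B\<close> zB _ diff2 pos] t by simp
  then have "0 < t * (grad \<phi> (z t) \<bullet> (y - x))"
    by (simp add: crit z_def)
  with t have "0 < grad \<phi> (z t) \<bullet> (y - x)"
    by (simp add: zero_less_mult_iff)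
  with eq show ?thesis
    by (simp add: z_def)
qed

text \<open>
  Existence of critical points for perturbed parameters, by minimization instead of a contraction
  argument.  The value of \<open>\<phi> w\<^sub>0\<close> on the sphere exceeds its value at the centre; because the sphere
  is compact, this persists for all \<open>w\<close> near \<open>w\<^sub>0\<close>.  The minimum of \<open>\<phi> w\<close> over the closed ball is
  then attained in the open ball, where the gradient must vanish.  The parameter thus enters only
  through the values of \<open>\<phi>\<close>.
\<close>

lemma nearby_critical_point:
  fixes \<phi> :: "'w::topological_space \<Rightarrow> real^'k \<Rightarrow> real"
  assumes "open S" and "0 < e" and sub: "{w\<^sub>0} \<times> cball v\<^sub>0 e \<subseteq> S"
    and cont: "continuous_on S (\<lambda>(w, v). \<phi> w v)"
    and diff: "\<And>w v. (w, v) \<in> S \<Longrightarrow> \<phi> w differentiable (at v)"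
    and diff2: "\<And>w v. (w, v) \<in> S \<Longrightarrow> grad (\<phi> w) differentiable (at v)"
    and pos: "\<And>w v d. (w, v) \<in> S \<Longrightarrow> d \<noteq> 0 \<Longrightarrow> 0 < d \<bullet> (hess (\<phi> w) v *v d)"
    and crit: "grad (\<phi> w\<^sub>0) v\<^sub>0 = 0"
  shows "\<exists>W. open W \<and> w\<^sub>0 \<in> W \<and> (\<forall>w\<in>W. \<exists>v\<in>ball v\<^sub>0 e. grad (\<phi> w) v = 0)"
proof -
  obtain W1 where W1: "open W1" "w\<^sub>0 \<in> W1" "W1 \<times> cball v\<^sub>0 e \<subseteq> S"
    using Elementary_Topology.tube_lemma[OF compact_cball \<open>open S\<close> sub] by blast
  define S' where "S' = W1 \<times> UNIV \<inter> S"
  have "open S'"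
    unfolding S'_def using W1(1) \<open>open S\<close> by (simp add: open_Times open_Int)
  have v0S: "(w, v\<^sub>0) \<in> S" if "w \<in> W1" for w
    using W1(3) that \<open>0 < e\<close> by auto
  define \<delta> where "\<delta> = (\<lambda>z. \<phi> (fst z) (snd z) - \<phi> (fst z) v\<^sub>0)"
  have cont': "continuous_on S (\<lambda>z. \<phi> (fst z) (snd z))"
    using cont by (simp add: case_prod_unfold)
  have "continuous_on S' (\<lambda>z. \<phi> (fst z) v\<^sub>0)"
  proof -
    have "continuous_on S' (\<lambda>z. (fst z, v\<^sub>0))"
      by (intro continuous_intros)
    moreover have "(\<lambda>z. (fst z, v\<^sub>0)) ` S' \<subseteq> S"
      using v0S by (auto simp: S'_def)
    ultimately show ?thesis
      using continuous_on_compose2[OF cont'] by fastforce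
  qed
  then have "continuous_on S' \<delta>"
    unfolding \<delta>_def using continuous_on_subset[OF cont']
    by (auto simp: S'_def intro!: continuous_intros)
  then have "open (S' \<inter> \<delta> -` {0<..})"
    using \<open>open S'\<close> by (auto simp: continuous_on_open_vimage Int_commute)
  moreover have "{w\<^sub>0} \<times> sphere v\<^sub>0 e \<subseteq> S' \<inter> \<delta> -` {0<..}"
  proof clarify
    fix v assume v: "v \<in> sphere v\<^sub>0 e"
    have in_S: "(w\<^sub>0, v') \<in> S" if "v' \<in> cball v\<^sub>0 e" for v'
      using that sub by auto
    have "\<phi> w\<^sub>0 v\<^sub>0 < \<phi> w\<^sub>0 v"
      using v \<open>0 < e\<close> crit
      by (intro strict_min_at_critical_point[of "cball v\<^sub>0 e"] diff diff2 pos in_S) auto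
    then show "(w\<^sub>0, v) \<in> S' \<inter> \<delta> -` {0<..}"
      using v sub W1(2) by (auto simp: S'_def \<delta>_def)
  qed
  ultimately obtain W2 where W2: "open W2" "w\<^sub>0 \<in> W2"
    "W2 \<times> sphere v\<^sub>0 e \<subseteq> S' \<inter> \<delta> -` {0<..}"
    using Elementary_Topology.tube_lemma[OF compact_sphere] by metis
  show ?thesis
  proof (intro exI[of _ "W1 \<inter> W2"] conjI ballI)
    fix w assume w: "w \<in> W1 \<inter> W2"
    have "continuous_on (cball v\<^sub>0 e) (\<phi> w)"
    proof -
      have "continuous_on (cball v\<^sub>0 e) (Pair w)"
        by (intro continuous_intros)
      moreover have "Pair w ` cball v\<^sub>0 e \<subseteq> S"
        using W1(3) w by auto
      ultimately show ?thesis
        using continuous_on_compose2[OF cont'] by fastforce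
    qed
    then obtain v where v: "v \<in> cball v\<^sub>0 e" and min: "\<And>v'. v' \<in> cball v\<^sub>0 e \<Longrightarrow> \<phi> w v \<le> \<phi> w v'"
      using continuous_attains_inf[of "cball v\<^sub>0 e" "\<phi> w"] \<open>0 < e\<close> by auto
    have "v \<notin> sphere v\<^sub>0 e"
    proof
      assume "v \<in> sphere v\<^sub>0 e"
      then have "\<phi> w v\<^sub>0 < \<phi> w v"
        using W2(3) w by (auto simp: \<delta>_def subset_iff)
      with min[of v\<^sub>0] \<open>0 < e\<close> show False
        by simp
    qed
    with v have ball: "v \<in> ball v\<^sub>0 e"
      by auto
    have "GDERIV (\<phi> w) v :> grad (\<phi> w) v"
      using W1(3) w v by (intro GDERIV_grad diff) auto
    then have "(\<lambda>h. h \<bullet> grad (\<phi> w) v) = (\<lambda>h. 0)"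
      unfolding gderiv_def
      using ball min by (intro differential_zero_maxmin[of v "ball v\<^sub>0 e" "\<phi> w"]) auto
    then have "grad (\<phi> w) v \<bullet> grad (\<phi> w) v = 0"
      by meson
    with ball show "\<exists>v\<in>ball v\<^sub>0 e. grad (\<phi> w) v = 0"
      by auto
  qed (use W1 W2 in auto)
qed

text \<open>
  An implicit function theorem for \<open>\<nabla>\<phi>(w, v) = 0\<close>, adapted to a positive Hessian.  Positivity is an
  open condition because the unit sphere is compact, so it holds on a product \<open>W \<times> ball v\<^sub>0 r\<close>;
  monotonicity of the gradient gives uniqueness on the ball, minimization gives existence, and
  minimization on arbitrarily small balls around \<open>u w\<close>, together with uniqueness on the large
  ball, gives continuity of \<open>u\<close> at \<open>w\<close>.
\<close>

lemma critical_point_branch: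
  fixes \<phi> :: "'w::topological_space \<Rightarrow> real^'k \<Rightarrow> real"
  assumes "open S" and "(w\<^sub>0, v\<^sub>0) \<in> S"
    and cont: "continuous_on S (\<lambda>(w, v). \<phi> w v)"
    and diff: "\<And>w v. (w, v) \<in> S \<Longrightarrow> \<phi> w differentiable (at v)"
    and diff2: "\<And>w v. (w, v) \<in> S \<Longrightarrow> grad (\<phi> w) differentiable (at v)"
    and cont2: "continuous_on S (\<lambda>(w, v). hess (\<phi> w) v)"
    and pos: "\<And>d. d \<noteq> 0 \<Longrightarrow> 0 < d \<bullet> (hess (\<phi> w\<^sub>0) v\<^sub>0 *v d)"
    and crit: "grad (\<phi> w\<^sub>0) v\<^sub>0 = 0"
  obtains W r u where "open W" and "w\<^sub>0 \<in> W" and "0 < r" and "W \<times> ball v\<^sub>0 r \<subseteq> S"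
    and "\<And>w. w \<in> W \<Longrightarrow> u w \<in> ball v\<^sub>0 r"
    and "\<And>w v. w \<in> W \<Longrightarrow> v \<in> ball v\<^sub>0 r \<Longrightarrow> grad (\<phi> w) v = 0 \<longleftrightarrow> v = u w"
    and "continuous_on W u"
proof -
  have cont2': "continuous_on S (\<lambda>z. hess (\<phi> (fst z)) (snd z))"
    using cont2 by (simp add: case_prod_unfold)
  \<comment> \<open>Pairs of a point and a vector on which the Hessian form is positive.  The unit vectors over
    \<open>(w\<^sub>0, v\<^sub>0)\<close> form a compact subset of this open set, so a whole tube around them lies in it.\<close>
  define Z where "Z = (S \<times> UNIV) \<inter> (\<lambda>(z, d). d \<bullet> (hess (\<phi> (fst z)) (snd z) *v d)) -` {0<..}"
  have "continuous_on (S \<times> UNIV) (\<lambda>z. hess (\<phi> (fst (fst z))) (snd (fst z)))"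
    by (rule continuous_on_compose2[OF cont2']) (auto intro: continuous_intros)
  then have "continuous_on (S \<times> UNIV) (\<lambda>z. hess (\<phi> (fst (fst z))) (snd (fst z)) *v snd z)"
    unfolding matrix_vector_mult_def by (intro continuous_intros)
  then have "continuous_on (S \<times> UNIV) (\<lambda>(z, d). d \<bullet> (hess (\<phi> (fst z)) (snd z) *v d))"
    by (auto simp: case_prod_unfold intro!: continuous_intros)
  then have "open Z"
    unfolding Z_def using \<open>open S\<close>
    by (simp add: continuous_on_open_vimage open_Times Int_commute)
  moreover have "{(w\<^sub>0, v\<^sub>0)} \<times> sphere 0 1 \<subseteq> Z"
  proof -
    have "0 < d \<bullet> (hess (\<phi> w\<^sub>0) v\<^sub>0 *v d)" if "norm d = 1" for d
      using that by (intro pos) auto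
    then show ?thesis
      using assms(2) by (auto simp: Z_def)
  qed
  ultimately obtain X where X: "open X" "(w\<^sub>0, v\<^sub>0) \<in> X" "X \<times> sphere 0 1 \<subseteq> Z"
    using Elementary_Topology.tube_lemma[OF compact_sphere] by metis
  obtain W1 V where W1: "open W1" "open V" "w\<^sub>0 \<in> W1" "v\<^sub>0 \<in> V" "W1 \<times> V \<subseteq> X \<inter> S"
  proof (rule open_prod_elim)
    show "open (X \<inter> S)" and "(w\<^sub>0, v\<^sub>0) \<in> X \<inter> S"
      using X \<open>open S\<close> assms(2) by auto
  qed auto
  obtain r where r: "0 < r" "ball v\<^sub>0 r \<subseteq> V"
    using W1(2,4) openE by blast
  define S' where "S' = W1 \<times> ball v\<^sub>0 r"
  have S': "S' \<subseteq> X" "S' \<subseteq> S"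
    using W1(5) r(2) by (auto simp: S'_def)
  have pos': "0 < d \<bullet> (hess (\<phi> w) v *v d)" if "(w, v) \<in> S'" "d \<noteq> 0" for w v d
  proof -
    have "((w, v), sgn d) \<in> Z"
      using that X(3) S'(1) by (force simp: norm_sgn)
    then have "0 < sgn d \<bullet> (hess (\<phi> w) v *v sgn d)"
      by (auto simp: Z_def)
    then have "0 < (norm d * norm d) * (sgn d \<bullet> (hess (\<phi> w) v *v sgn d))"
      using \<open>d \<noteq> 0\<close> by simp
    also have "\<dots> = (norm d *\<^sub>R sgn d) \<bullet> (hess (\<phi> w) v *v (norm d *\<^sub>R sgn d))"
      by (simp add: matrix_vector_mult_scaleR)
    also have "norm d *\<^sub>R sgn d = d"
      using \<open>d \<noteq> 0\<close> by (simp add: sgn_div_norm)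
    finally show ?thesis .
  qed
  have "open S'"
    unfolding S'_def using W1(1) by (simp add: open_Times)
  have cont': "continuous_on S' (\<lambda>(w, v). \<phi> w v)"
    using cont S'(2) continuous_on_subset by blast
  have diff': "\<phi> w differentiable (at v)" "grad (\<phi> w) differentiable (at v)" if "(w, v) \<in> S'" for w v
    using that S'(2) diff diff2 by auto
  have near: "\<exists>W. open W \<and> w \<in> W \<and> (\<forall>w'\<in>W. \<exists>v'\<in>ball v e. grad (\<phi> w') v' = 0)"
    if z: "(w, v) \<in> S'" "grad (\<phi> w) v = 0" "0 < e" "cball v e \<subseteq> ball v\<^sub>0 r" for w v e
  proof -
    have "{w} \<times> cball v e \<subseteq> S'"
      using z(1,4) unfolding S'_def by blast
    then show ?thesis
      by (rule nearby_critical_point[OF \<open>open S'\<close> z(3) _ cont' diff' pos' z(2)])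
  qed
  have uniq: "v = v'" if "(w, v) \<in> S'" "(w, v') \<in> S'" "grad (\<phi> w) v = 0" "grad (\<phi> w) v' = 0" for w v v'
  proof (rule ccontr)
    assume "v \<noteq> v'"
    then have "0 < (grad (\<phi> w) v' - grad (\<phi> w) v) \<bullet> (v' - v)"
      using that
      by (intro grad_strictly_monotone[of "ball v\<^sub>0 r"] diff'(2) pos') (simp_all add: S'_def)
    with that show False
      by simp
  qed
  have "(w\<^sub>0, v\<^sub>0) \<in> S'"
    using W1(3) r(1) by (simp add: S'_def)
  moreover have "cball v\<^sub>0 (r/2) \<subseteq> ball v\<^sub>0 r"
    using r(1) by auto
  ultimately obtain W2 where W2: "open W2" "w\<^sub>0 \<in> W2"
    "\<And>w. w \<in> W2 \<Longrightarrow> \<exists>v\<in>ball v\<^sub>0 (r/2). grad (\<phi> w) v = 0"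
    using near[of w\<^sub>0 v\<^sub>0 "r/2"] crit r(1) by (meson half_gt_zero)
  define W where "W = W1 \<inter> W2"
  have ex: "\<exists>v. v \<in> ball v\<^sub>0 r \<and> grad (\<phi> w) v = 0" if w: "w \<in> W" for w
  proof -
    obtain v where "v \<in> ball v\<^sub>0 (r/2)" "grad (\<phi> w) v = 0"
      using W2(3)[of w] w unfolding W_def by blast
    then show ?thesis
      using r(1) by (intro exI[of _ v]) auto
  qed
  define u where "u w = (SOME v. v \<in> ball v\<^sub>0 r \<and> grad (\<phi> w) v = 0)" for w
  have u: "u w \<in> ball v\<^sub>0 r" "grad (\<phi> w) (u w) = 0" if "w \<in> W" for w
    using someI_ex[OF ex[OF that]] by (auto simp: u_def)
  have u_uniq: "grad (\<phi> w) v = 0 \<longleftrightarrow> v = u w" if "w \<in> W" "v \<in> ball v\<^sub>0 r" for w v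
    using u[OF that(1)] uniq[of w v "u w"] that by (auto simp: S'_def W_def)
  have "open W"
    using W1 W2 by (auto simp: W_def)
  have "continuous_on W u"
    unfolding continuous_on_def
  proof (intro ballI tendstoI)
    fix w and \<epsilon> :: real assume w: "w \<in> W" and "0 < \<epsilon>"
    obtain e0 where e0: "0 < e0" "cball (u w) e0 \<subseteq> ball v\<^sub>0 r"
      using u(1)[OF w] open_contains_cball[of "ball v\<^sub>0 r"] by (meson open_ball)
    define e where "e = min e0 \<epsilon>"
    have e: "0 < e" "e \<le> \<epsilon>" "cball (u w) e \<subseteq> ball v\<^sub>0 r"
      using e0 \<open>0 < \<epsilon>\<close> by (auto simp: e_def)
    have "(w, u w) \<in> S'"
      using u[OF w] w by (simp add: S'_def W_def)
    then obtain W' where W': "open W'" "w \<in> W'"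
      "\<And>w'. w' \<in> W' \<Longrightarrow> \<exists>v\<in>ball (u w) e. grad (\<phi> w') v = 0"
      using near[OF _ u(2)[OF w] e(1,3)] by blast
    show "\<forall>\<^sub>F w' in at w within W. dist (u w') (u w) < \<epsilon>"
    proof (rule eventually_at_topological[THEN iffD2], intro exI[of _ "W \<inter> W'"] conjI ballI impI)
      fix w' assume w': "w' \<in> W \<inter> W'"
      then obtain v where v: "v \<in> ball (u w) e" "grad (\<phi> w') v = 0"
        using W'(3) by blast
      then have "v \<in> ball v\<^sub>0 r"
        using e(3) ball_subset_cball by blast
      then have "v = u w'"
        using u_uniq[of w' v] w' v by simp
      with v e(2) show "dist (u w') (u w) < \<epsilon>"
        by (simp add: dist_commute)
    qed (use \<open>open W\<close> W' w in auto)
  qed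
  moreover have "W \<times> ball v\<^sub>0 r \<subseteq> S"
    using S'(2) by (auto simp: W_def S'_def)
  moreover have "w\<^sub>0 \<in> W"
    using W1(3) W2(2) by (simp add: W_def)
  ultimately show thesis
    using that \<open>open W\<close> r(1) u(1) u_uniq by presburger
qed

section \<open>The Hamiltonian and the control law\<close>

context
  fixes M :: "('n::finite, 'm::finite) ocp"
  assumes M: "standing_assumptions M"
begin

lemma standing_facts:
  shows "open (conf M)"
    and "\<exists>K. K-lipschitz_on (conf M \<times> UNIV) (\<lambda>(q, p). vel M q p)"
    and "\<exists>K. K-lipschitz_on (conf M \<times> UNIV \<times> ctrl M) (\<lambda>(q, p, u). mom M q p u)"
    and "\<forall>q\<in>conf M. \<forall>p. (\<lambda>(q', p'). vel M q' p') differentiable (at (q, p))"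
    and "\<forall>q\<in>conf M. \<forall>p. \<forall>u\<in>interior (ctrl M).
        (\<lambda>(q', p', u'). mom M q' p' u') differentiable (at (q, p, u))"
    and "continuous_on (conf M \<times> UNIV \<times> ctrl M) (\<lambda>(q, p, u). cost M q p u)"
    and "Ck_on 1 (\<lambda>(q, p, u). cost M q p u) (conf M \<times> UNIV \<times> interior (ctrl M))"
    and "Ck_on 1 (\<lambda>(q, p). final_cost M q p) (conf M \<times> UNIV)"
    and "\<forall>q\<in>conf M. \<forall>p lam \<psi>. \<forall>u\<in>interior (ctrl M).
        grad (\<lambda>v. hamiltonian M q p v lam \<psi> 1) differentiable (at u)"
    and "continuous_on (conf M \<times> UNIV \<times> UNIV \<times> UNIV \<times> interior (ctrl M))
       (\<lambda>(q, p, lam, \<psi>, u). hess (\<lambda>v. hamiltonian M q p v lam \<psi> 1) u)"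
  by (insert M[unfolded standing_assumptions_def]) (elim conjE, assumption)+

lemma state_maps_differentiable:
  assumes "q \<in> conf M"
  shows "(\<lambda>x. vel M x p) differentiable (at q)" and "vel M q differentiable (at p)"
    and "(\<lambda>x. final_cost M x p) differentiable (at q)" and "final_cost M q differentiable (at p)"
proof -
  have "(\<lambda>(x, y). vel M x y) differentiable (at (q, p))"
    and "(\<lambda>(x, y). final_cost M x y) differentiable (at (q, p))"
    using standing_facts(4) Ck_on_1_differentiable[OF standing_facts(8)] assms by simp_all
  from differentiable_partial2[OF this(1)] differentiable_partial2[OF this(2)]
  show "(\<lambda>x. vel M x p) differentiable (at q)" and "vel M q differentiable (at p)"
    and "(\<lambda>x. final_cost M x p) differentiable (at q)" and "final_cost M q differentiable (at p)"
    by simp_all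
qed

lemma controlled_maps_differentiable:
  assumes "q \<in> conf M" and "v \<in> interior (ctrl M)"
  shows "(\<lambda>x. cost M x p v) differentiable (at q)" and "(\<lambda>y. cost M q y v) differentiable (at p)"
    and "cost M q p differentiable (at v)"
    and "(\<lambda>x. mom M x p v) differentiable (at q)" and "(\<lambda>y. mom M q y v) differentiable (at p)"
    and "mom M q p differentiable (at v)"
proof -
  have "(\<lambda>(x, y, z). cost M x y z) differentiable (at (q, p, v))"
    and "(\<lambda>(x, y, z). mom M x y z) differentiable (at (q, p, v))"
    using standing_facts(5) Ck_on_1_differentiable[OF standing_facts(7)] assms by simp_all
  from differentiable_partial3[OF this(1)] differentiable_partial3[OF this(2)]
  show "(\<lambda>x. cost M x p v) differentiable (at q)" and "(\<lambda>y. cost M q y v) differentiable (at p)"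
    and "cost M q p differentiable (at v)"
    and "(\<lambda>x. mom M x p v) differentiable (at q)" and "(\<lambda>y. mom M q y v) differentiable (at p)"
    and "mom M q p differentiable (at v)"
    by simp_all
qed

text \<open>
  At the control given by the control law, the first two gradients are \<open>-\<nu>\<close> and \<open>-\<eta>\<close>; the third
  one is the expression set to zero in the stationarity condition.
\<close>

lemma GDERIV_hamiltonian:
  assumes "q \<in> conf M" and "v \<in> interior (ctrl M)"
  shows "GDERIV (\<lambda>x. hamiltonian M x p v lam \<psi> 1) q :>
      grad (\<lambda>x. cost M x p v) q + lam v* jacobian (\<lambda>x. vel M x p) (at q)
        + \<psi> v* jacobian (\<lambda>x. mom M x p v) (at q)"
    and "GDERIV (\<lambda>y. hamiltonian M q y v lam \<psi> 1) p :>
      grad (\<lambda>y. cost M q y v) p + lam v* jacobian (\<lambda>y. vel M q y) (at p)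
        + \<psi> v* jacobian (\<lambda>y. mom M q y v) (at p)"
    and "GDERIV (\<lambda>z. hamiltonian M q p z lam \<psi> 1) v :>
      grad (cost M q p) v + \<psi> v* jacobian (mom M q p) (at v)"
proof -
  note D = controlled_maps_differentiable[OF assms, of p]
  note E = state_maps_differentiable[OF assms(1), of p]
  note rule3 = GDERIV_add[OF GDERIV_add[OF GDERIV_grad GDERIV_inner_jacobian] GDERIV_inner_jacobian]
  show "GDERIV (\<lambda>x. hamiltonian M x p v lam \<psi> 1) q :>
      grad (\<lambda>x. cost M x p v) q + lam v* jacobian (\<lambda>x. vel M x p) (at q)
        + \<psi> v* jacobian (\<lambda>x. mom M x p v) (at q)"
    unfolding hamiltonian_def mult_1 by (rule rule3[OF D(1) E(1) D(4)])
  show "GDERIV (\<lambda>y. hamiltonian M q y v lam \<psi> 1) p :>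
      grad (\<lambda>y. cost M q y v) p + lam v* jacobian (\<lambda>y. vel M q y) (at p)
        + \<psi> v* jacobian (\<lambda>y. mom M q y v) (at p)"
    unfolding hamiltonian_def mult_1 by (rule rule3[OF D(2) E(2) D(5)])
  show "GDERIV (\<lambda>z. hamiltonian M q p z lam \<psi> 1) v :>
      grad (cost M q p) v + \<psi> v* jacobian (mom M q p) (at v)"
    using GDERIV_add[OF GDERIV_add[OF GDERIV_grad[OF D(3)] GDERIV_const]
        GDERIV_inner_jacobian[OF D(6)], of "lam \<bullet> vel M q p" \<psi>]
    unfolding hamiltonian_def mult_1 add_0_right .
qed

lemma stationary_iff_grad_hamiltonian:
  assumes "q \<in> conf M" and "v \<in> interior (ctrl M)"
  shows "stationary M q p \<psi> v \<longleftrightarrow> grad (\<lambda>z. hamiltonian M q p z lam \<psi> 1) v = 0"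
  unfolding stationary_def grad_eqI[OF GDERIV_hamiltonian(3)[OF assms]] by (rule eq_commute)

lemma hamiltonian_continuous:
  "continuous_on ((conf M \<times> UNIV \<times> UNIV \<times> UNIV) \<times> ctrl M)
     (\<lambda>((q, p, lam, \<psi>), v). hamiltonian M q p v lam \<psi> 1)"
    (is "continuous_on ?S _")
proof -
  have "continuous_on (conf M \<times> UNIV) (\<lambda>z. vel M (fst z) (snd z))"
    and "continuous_on (conf M \<times> UNIV \<times> ctrl M) (\<lambda>z. mom M (fst z) (fst (snd z)) (snd (snd z)))"
    and "continuous_on (conf M \<times> UNIV \<times> ctrl M) (\<lambda>z. cost M (fst z) (fst (snd z)) (snd (snd z)))"
    using standing_facts(2,3,6) unfolding case_prod_unfold
    by (blast intro: lipschitz_on_continuous_on)+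
  note maps = this[THEN continuous_on_compose2]
  have "continuous_on ?S (\<lambda>z. vel M (fst (fst z)) (fst (snd (fst z))))"
    by (rule maps(1)[where f = "\<lambda>z. (fst (fst z), fst (snd (fst z)))", simplified])
       (auto intro!: continuous_intros)
  moreover have "continuous_on ?S (\<lambda>z. mom M (fst (fst z)) (fst (snd (fst z))) (snd z))"
    by (rule maps(2)[where f = "\<lambda>z. (fst (fst z), fst (snd (fst z)), snd z)", simplified])
       (auto intro!: continuous_intros)
  moreover have "continuous_on ?S (\<lambda>z. cost M (fst (fst z)) (fst (snd (fst z))) (snd z))"
    by (rule maps(3)[where f = "\<lambda>z. (fst (fst z), fst (snd (fst z)), snd z)", simplified])
       (auto intro!: continuous_intros)
  ultimately show ?thesis
    unfolding hamiltonian_def case_prod_unfold by (intro continuous_intros)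
qed

text \<open>
  A control is stationary exactly if it is a critical point of the Hamiltonian
  (\<open>stationary_iff_grad_hamiltonian\<close>).  The Hessian is positive at \<open>v\<close>, so the critical points near \<open>v\<close> form a continuous
  branch over the neighbouring extended states, and \<open>\<Omega>\<close> can be taken to be the product of a set of
  such states with a ball around \<open>v\<close>.
\<close>

lemma control_law_exists:
  assumes "q \<in> conf M" and "v \<in> interior (ctrl M)" and "stationary M q p \<psi> v"
    and "sym_pos_def (hess (\<lambda>z. hamiltonian M q p z lam \<psi> 1) v)"
  shows "\<exists>\<Omega> u. open \<Omega> \<and> ((q, p, lam, \<psi>), v) \<in> \<Omega> \<and> control_law M \<Omega> u \<and> continuous_on (Domain \<Omega>) u"
proof -
  define S where "S = (conf M \<times> UNIV \<times> UNIV \<times> UNIV :: 'n ext_state set) \<times> interior (ctrl M)"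
  define \<phi> where "\<phi> = (\<lambda>(q, p, lam, \<psi>) v. hamiltonian M q p v lam \<psi> 1)"
  have "open S"
    unfolding S_def by (intro open_Times standing_facts(1)) simp_all
  moreover have "((q, p, lam, \<psi>), v) \<in> S"
    using assms by (simp add: S_def)
  moreover have "continuous_on S (\<lambda>(w, v). \<phi> w v)"
  proof -
    have "S \<subseteq> (conf M \<times> UNIV \<times> UNIV \<times> UNIV) \<times> ctrl M"
      unfolding S_def using interior_subset by blast
    then have "continuous_on S (\<lambda>((q, p, lam, \<psi>), v). hamiltonian M q p v lam \<psi> 1)"
      by (rule continuous_on_subset[OF hamiltonian_continuous])
    then show ?thesis
      by (simp add: \<phi>_def case_prod_unfold)
  qed
  moreover have "\<phi> w differentiable (at v)" if "(w, v) \<in> S" for w v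
  proof -
    obtain q p lam \<psi> where w: "w = (q, p, lam, \<psi>)"
      by (cases w)
    have "GDERIV (\<phi> w) v :> grad (cost M q p) v + \<psi> v* jacobian (mom M q p) (at v)"
      using GDERIV_hamiltonian(3)[of q v] that by (simp add: \<phi>_def w S_def)
    then show ?thesis
      unfolding gderiv_def differentiable_def by blast
  qed
  moreover have "grad (\<phi> w) differentiable (at v)" if "(w, v) \<in> S" for w v
    using standing_facts(9) that by (auto simp: \<phi>_def S_def)
  moreover have "continuous_on S (\<lambda>(w, v). hess (\<phi> w) v)"
  proof -
    have "continuous_on S (\<lambda>((q, p, lam, \<psi>), u). (q, p, lam, \<psi>, u))"
      unfolding case_prod_unfold by (intro continuous_intros)
    with standing_facts(10) have "continuous_on S (\<lambda>z. (\<lambda>(q, p, lam, \<psi>, u). hess (\<lambda>v. hamiltonian M q p v lam \<psi> 1) u)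
        ((\<lambda>((q, p, lam, \<psi>), u). (q, p, lam, \<psi>, u)) z))"
      by (rule continuous_on_compose2) (auto simp: S_def)
    then show ?thesis
      by (simp add: \<phi>_def case_prod_unfold)
  qed
  moreover have "0 < d \<bullet> (hess (\<phi> (q, p, lam, \<psi>)) v *v d)" if "d \<noteq> 0" for d
    using assms(4) that by (simp add: \<phi>_def sym_pos_def_def)
  moreover have "grad (\<phi> (q, p, lam, \<psi>)) v = 0"
    using stationary_iff_grad_hamiltonian[OF assms(1,2), of p \<psi> lam] assms(3) by (simp add: \<phi>_def)
  ultimately obtain W r u where W: "open W" "(q, p, lam, \<psi>) \<in> W" "0 < r" "W \<times> ball v r \<subseteq> S"
    and u: "\<And>w. w \<in> W \<Longrightarrow> u w \<in> ball v r"
    and crit: "\<And>w z. w \<in> W \<Longrightarrow> z \<in> ball v r \<Longrightarrow> grad (\<phi> w) z = 0 \<longleftrightarrow> z = u w"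
    and cont: "continuous_on W u"
    by (rule critical_point_branch) (blast | assumption)+
  have "Domain (W \<times> ball v r) = W"
    using W(3) by (simp add: Domain_fst fst_image_times)
  moreover have "control_law M (W \<times> ball v r) u"
    unfolding control_law_def
  proof (intro conjI allI impI)
    fix q p lam \<psi> z assume z: "((q, p, lam, \<psi>), z) \<in> W \<times> ball v r"
    then have "q \<in> conf M" "z \<in> interior (ctrl M)"
      using W(4) unfolding S_def by blast+
    then show "stationary M q p \<psi> z \<longleftrightarrow> z = u (q, p, lam, \<psi>)"
      using crit[of "(q, p, lam, \<psi>)" z] z
      by (simp add: stationary_iff_grad_hamiltonian[of q z p \<psi> lam] \<phi>_def)
  qed (use W(4) u in \<open>auto simp: S_def\<close>)
  ultimately show ?thesis
    using W cont by (intro exI[of _ "W \<times> ball v r"] exI[of _ u]) (auto intro: open_Times)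
qed

end

section \<open>The discrete Lagrangian in the transformed multipliers\<close>

lemma scaled_equation_iff:
  fixes G y z :: "'v::real_vector"
  assumes "a \<noteq> 0" and "b \<noteq> 0"
  shows "(a * b) *\<^sub>R G + (y + b *\<^sub>R z) = 0 \<longleftrightarrow> - G = (1 / (a * b)) *\<^sub>R y + (1 / a) *\<^sub>R z"
proof -
  have "(a * b) *\<^sub>R G + (y + b *\<^sub>R z) = (a * b) *\<^sub>R (G + ((1 / (a * b)) *\<^sub>R y + (1 / a) *\<^sub>R z))"
    using assms by (simp add: scaleR_right_distrib)
  then have "(a * b) *\<^sub>R G + (y + b *\<^sub>R z) = 0 \<longleftrightarrow> G + ((1 / (a * b)) *\<^sub>R y + (1 / a) *\<^sub>R z) = 0"
    using assms by simp
  also have "\<dots> \<longleftrightarrow> - G = (1 / (a * b)) *\<^sub>R y + (1 / a) *\<^sub>R z"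
    by (metis neg_eq_iff_add_eq_0)
  finally show ?thesis .
qed

lemma sum_fun_upd:
  fixes F :: "'i \<Rightarrow> 'v \<Rightarrow> real"
  assumes "finite A" and "k \<in> A"
  shows "(\<Sum>l\<in>A. F l ((x(k := y)) l)) = (\<Sum>l\<in>A. F l (x l)) + (F k y - F k (x k))"
proof -
  have "(\<Sum>l\<in>A - {k}. F l ((x(k := y)) l)) = (\<Sum>l\<in>A - {k}. F l (x l))"
    by (intro sum.cong) auto
  then show ?thesis
    using assms by (simp add: sum.remove[of A k])
qed

lemma sum_fun_upd2:
  fixes F :: "'i \<Rightarrow> 'j \<Rightarrow> 'v \<Rightarrow> real"
  assumes "finite A" and "k \<in> A" and "finite B" and "i \<in> B"
  shows "(\<Sum>l\<in>A. \<Sum>j\<in>B. F l j ((X(k := (X k)(i := y))) l j)) =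
    (\<Sum>l\<in>A. \<Sum>j\<in>B. F l j (X l j)) + (F k i y - F k i (X k i))"
  using sum_fun_upd[OF assms(1,2), of "\<lambda>l z. \<Sum>j\<in>B. F l j (z j)" X "(X k)(i := y)"]
    sum_fun_upd[OF assms(3,4), of "F k" "X k" y] by simp

text \<open>
  A shift of the index turns a sum over steps, each involving its two end points, into a sum over
  nodes.  The value \<open>a N\<close> belongs to no step, hence the case distinction.
\<close>

lemma sum_nodes_by_parts:
  fixes a b x :: "nat \<Rightarrow> 'v::real_inner"
  shows "(\<Sum>k<N. a k \<bullet> x k - b (Suc k) \<bullet> x (Suc k)) - b 0 \<bullet> x 0 =
    (\<Sum>k\<le>N. ((if k < N then a k else 0) - b k) \<bullet> x k)"
proof -
  have "(\<Sum>k\<le>N. ((if k < N then a k else 0) - b k) \<bullet> x k) =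
      (\<Sum>k\<le>N. (if k < N then a k else 0) \<bullet> x k) - (\<Sum>k\<le>N. b k \<bullet> x k)"
    by (simp add: inner_diff_left sum_subtractf)
  moreover have "(\<Sum>k\<le>N. (if k < N then a k else 0) \<bullet> x k) = (\<Sum>k<N. a k \<bullet> x k)"
    by (simp add: lessThan_Suc_atMost[symmetric])
  moreover have "(\<Sum>k\<le>N. b k \<bullet> x k) = b 0 \<bullet> x 0 + (\<Sum>k<N. b (Suc k) \<bullet> x (Suc k))"
    by (simp only: lessThan_Suc_atMost[symmetric] sum.lessThan_Suc_shift)
  ultimately show ?thesis
    by (simp add: sum_subtractf)
qed

lemma sum_inner_transpose:
  fixes y x :: "nat \<Rightarrow> 'v::real_inner"
  shows "(\<Sum>i\<in>I. y i \<bullet> (\<Sum>j\<in>I. a i j *\<^sub>R x j)) = (\<Sum>j\<in>I. (\<Sum>i\<in>I. a i j *\<^sub>R y i) \<bullet> x j)"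
  unfolding inner_sum_right inner_sum_left inner_scaleR_right inner_scaleR_left by (rule sum.swap)

context
  fixes M :: "('n::finite, 'm::finite) ocp" and s :: nat and c :: "nat \<Rightarrow> real" and N :: nat
    and lam \<mu> :: "nat \<Rightarrow> real^'n" and \<psi>0 :: "real^'n"
    and \<Lambda> \<Psi> \<Gamma> chi :: "nat \<Rightarrow> nat \<Rightarrow> real^'n"
  assumes M: "standing_assumptions M" and b: "\<forall>i\<in>{1..s}. sg_b s c i > 0" and N: "1 \<le> N"
    and mult: "stage_multipliers s c N \<Lambda> \<Psi> \<Gamma> chi"
begin

abbreviation (input) "h \<equiv> step_size M N"
abbreviation (input) "weight \<equiv> sg_b s c"
abbreviation (input) "chi_left k \<equiv> \<Sum>i=1..s. sg_alpha s c i *\<^sub>R chi k i"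
abbreviation (input) "chi_right k \<equiv> \<Sum>i=1..s. sg_beta s c i *\<^sub>R chi k i"

text \<open>
  The coefficients of the node values \<open>q k\<close>, \<open>p k\<close> and the stage values \<open>Q k i\<close>, \<open>P k i\<close> in the part
  of the discrete Lagrangian that is linear in them.  The multiplier \<open>\<psi>0\<close> of the initial condition
  takes the place of a value coming from the step before the first one.
\<close>

definition "q_coeff k = (if k < N then \<mu> k else 0) - lam k"

definition "p_coeff k =
  (if k < N then chi_left k else 0) - (case k of 0 \<Rightarrow> \<psi>0 | Suc l \<Rightarrow> chi_right l)"

definition "Q_coeff k i = sg_beta s c i *\<^sub>R lam (Suc k) - sg_alpha s c i *\<^sub>R \<mu> k +
  weight i *\<^sub>R (\<Sum>j=1..s. sg_abar s c i j *\<^sub>R \<Gamma> k j)"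

definition "P_coeff k i = weight i *\<^sub>R (\<Sum>j=1..s. sg_a s c i j *\<^sub>R chi k j)"

definition "weighted_ham k i Q P U = h * weight i * hamiltonian M Q P U (\<Gamma> k i) (chi k i) 1"

text \<open>
  This is where the relation \<open>b\<^sub>i a\<^sub>i\<^sub>j + b'\<^sub>j a'\<^sub>j\<^sub>i = 0\<close> (primes for bars) enters.  Summing against a
  multiplier transposes the coefficient matrix; the rescaling by the weights turns the transpose of
  \<open>a\<close> into \<open>-a'\<close> and the transpose of \<open>a'\<close> into \<open>-a\<close>, up to one overall weight per stage.  Therefore \<open>\<Gamma>\<close>, the multiplier of the
  \<open>q\<close>-equations, is discretized with the coefficients of \<open>p\<close>, and \<open>chi\<close> with those of \<open>q\<close>.
\<close>

lemma stage_linear_part: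
  assumes "k < N"
  shows "(\<Sum>i=1..s. \<Lambda> k i \<bullet> (\<Sum>j=1..s. sg_a s c i j *\<^sub>R X j)) =
      - (\<Sum>i=1..s. (weight i *\<^sub>R (\<Sum>j=1..s. sg_abar s c i j *\<^sub>R \<Gamma> k j)) \<bullet> X i)"
    and "(\<Sum>i=1..s. \<Psi> k i \<bullet> (\<Sum>j=1..s. sg_abar s c i j *\<^sub>R X j)) =
      - (\<Sum>i=1..s. P_coeff k i \<bullet> X i)"
proof -
  have L: "\<Lambda> k i = weight i *\<^sub>R \<Gamma> k i" "\<Psi> k i = weight i *\<^sub>R chi k i" "weight i \<noteq> 0" if "i \<in> {1..s}" for i
    using mult b that assms by (force simp: stage_multipliers_def)+
  have 1: "(\<Sum>i=1..s. sg_a s c i j *\<^sub>R \<Lambda> k i) = - (weight j *\<^sub>R (\<Sum>i=1..s. sg_abar s c j i *\<^sub>R \<Gamma> k i))"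
    if "j \<in> {1..s}" for j
    unfolding scaleR_sum_right sum_negf[symmetric]
    using L that by (intro sum.cong) (auto simp: sg_abar_def)
  have 2: "(\<Sum>i=1..s. sg_abar s c i j *\<^sub>R \<Psi> k i) = - P_coeff k j" if "j \<in> {1..s}" for j
    unfolding P_coeff_def scaleR_sum_right sum_negf[symmetric]
    using L that by (intro sum.cong) (auto simp: sg_abar_def)
  show "(\<Sum>i=1..s. \<Lambda> k i \<bullet> (\<Sum>j=1..s. sg_a s c i j *\<^sub>R X j)) =
      - (\<Sum>i=1..s. (weight i *\<^sub>R (\<Sum>j=1..s. sg_abar s c i j *\<^sub>R \<Gamma> k j)) \<bullet> X i)"
    unfolding sum_inner_transpose sum_negf[symmetric]
    by (intro sum.cong refl) (simp only: 1 inner_minus_left)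
  show "(\<Sum>i=1..s. \<Psi> k i \<bullet> (\<Sum>j=1..s. sg_abar s c i j *\<^sub>R X j)) = - (\<Sum>i=1..s. P_coeff k i \<bullet> X i)"
    unfolding sum_inner_transpose sum_negf[symmetric]
    by (intro sum.cong refl) (simp only: 2 inner_minus_left)
qed

text \<open>
  With \<open>\<Lambda> = b\<Gamma>\<close> and \<open>\<Psi> = b chi\<close>, the cost and the nonlinear parts of the two constraints combine to
  the Hamiltonian, with the same quadrature weight \<open>h b\<^sub>i\<close> on all three terms.  Everything else
  is linear in the primal variables and is sorted here by variable, so that each partial gradient
  involves, apart from the final cost, a single summand.
\<close>

lemma discrete_lagrangian_regrouped:
  "discrete_lagrangian M s c N q p Q P U lam \<mu> \<psi>0 \<Lambda> \<Psi> =
    final_cost M (q N) (p N) + (\<Sum>k\<le>N. q_coeff k \<bullet> q k) + (\<Sum>k\<le>N. p_coeff k \<bullet> p k) +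
    (\<Sum>k<N. \<Sum>i=1..s. weighted_ham k i (Q k i) (P k i) (U k i) +
       Q_coeff k i \<bullet> Q k i + P_coeff k i \<bullet> P k i) +
    (lam 0 \<bullet> q_init M + \<psi>0 \<bullet> p_init M)"
proof -
  have L: "\<Lambda> k i = weight i *\<^sub>R \<Gamma> k i" "\<Psi> k i = weight i *\<^sub>R chi k i" "weight i \<noteq> 0"
    if "k < N" "i \<in> {1..s}" for k i
    using mult b that by (force simp: stage_multipliers_def)+
  have stage: "(\<Sum>i=1..s. h * weight i * cost M (Q k i) (P k i) (U k i)) +
      (\<mu> k \<bullet> (q k - (\<Sum>j=1..s. sg_alpha s c j *\<^sub>R Q k j))
        - lam (Suc k) \<bullet> (q (Suc k) - (\<Sum>j=1..s. sg_beta s c j *\<^sub>R Q k j)) +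
        (\<Sum>i=1..s.
           \<Lambda> k i \<bullet> (h *\<^sub>R vel M (Q k i) (P k i) - (\<Sum>j=1..s. sg_a s c i j *\<^sub>R Q k j)) +
           \<Psi> k i \<bullet> (h *\<^sub>R mom M (Q k i) (P k i) (U k i) -
                     (1 / weight i) *\<^sub>R (sg_beta s c i *\<^sub>R p (Suc k) - sg_alpha s c i *\<^sub>R p k) -
                     (\<Sum>j=1..s. sg_abar s c i j *\<^sub>R P k j)))) =
      (\<mu> k \<bullet> q k - lam (Suc k) \<bullet> q (Suc k)) + (chi_left k \<bullet> p k - chi_right k \<bullet> p (Suc k)) +
      (\<Sum>i=1..s. weighted_ham k i (Q k i) (P k i) (U k i) +
         Q_coeff k i \<bullet> Q k i + P_coeff k i \<bullet> P k i)" if k: "k < N" for k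
  proof -
    have "(\<Sum>i=1..s.
           \<Lambda> k i \<bullet> (h *\<^sub>R vel M (Q k i) (P k i) - (\<Sum>j=1..s. sg_a s c i j *\<^sub>R Q k j)) +
           \<Psi> k i \<bullet> (h *\<^sub>R mom M (Q k i) (P k i) (U k i) -
                     (1 / weight i) *\<^sub>R (sg_beta s c i *\<^sub>R p (Suc k) - sg_alpha s c i *\<^sub>R p k) -
                     (\<Sum>j=1..s. sg_abar s c i j *\<^sub>R P k j))) =
        (\<Sum>i=1..s. h * weight i * (\<Gamma> k i \<bullet> vel M (Q k i) (P k i) + chi k i \<bullet> mom M (Q k i) (P k i) (U k i)))
        - (\<Sum>i=1..s. \<Lambda> k i \<bullet> (\<Sum>j=1..s. sg_a s c i j *\<^sub>R Q k j))
        - (\<Sum>i=1..s. \<Psi> k i \<bullet> (\<Sum>j=1..s. sg_abar s c i j *\<^sub>R P k j))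
        - (\<Sum>i=1..s. chi k i \<bullet> (sg_beta s c i *\<^sub>R p (Suc k) - sg_alpha s c i *\<^sub>R p k))"
      unfolding sum_subtractf[symmetric]
      by (intro sum.cong refl) (use L[OF k] in \<open>simp add: inner_diff_right distrib_left diff_divide_distrib\<close>)
    moreover have "(\<Sum>i=1..s. chi k i \<bullet> (sg_beta s c i *\<^sub>R p (Suc k) - sg_alpha s c i *\<^sub>R p k)) =
        chi_right k \<bullet> p (Suc k) - chi_left k \<bullet> p k"
      by (simp add: inner_sum_left inner_diff_right sum_subtractf)
    moreover have "\<mu> k \<bullet> (\<Sum>j=1..s. sg_alpha s c j *\<^sub>R Q k j) = (\<Sum>i=1..s. (sg_alpha s c i *\<^sub>R \<mu> k) \<bullet> Q k i)"
      and "lam (Suc k) \<bullet> (\<Sum>j=1..s. sg_beta s c j *\<^sub>R Q k j) =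
        (\<Sum>i=1..s. (sg_beta s c i *\<^sub>R lam (Suc k)) \<bullet> Q k i)"
      by (simp_all add: inner_sum_right)
    moreover have "(\<Sum>i=1..s. weighted_ham k i (Q k i) (P k i) (U k i) +
           Q_coeff k i \<bullet> Q k i + P_coeff k i \<bullet> P k i) =
        (\<Sum>i=1..s. h * weight i * cost M (Q k i) (P k i) (U k i)) +
        (\<Sum>i=1..s. h * weight i * (\<Gamma> k i \<bullet> vel M (Q k i) (P k i) + chi k i \<bullet> mom M (Q k i) (P k i) (U k i))) +
        (\<Sum>i=1..s. (sg_beta s c i *\<^sub>R lam (Suc k)) \<bullet> Q k i)
        - (\<Sum>i=1..s. (sg_alpha s c i *\<^sub>R \<mu> k) \<bullet> Q k i)
        + (\<Sum>i=1..s. (weight i *\<^sub>R (\<Sum>j=1..s. sg_abar s c i j *\<^sub>R \<Gamma> k j)) \<bullet> Q k i)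
        + (\<Sum>i=1..s. P_coeff k i \<bullet> P k i)"
      unfolding sum_subtractf[symmetric] sum.distrib[symmetric]
      by (intro sum.cong refl)
         (simp add: weighted_ham_def hamiltonian_def Q_coeff_def inner_add_left inner_diff_left distrib_left)
    ultimately show ?thesis
      unfolding stage_linear_part[OF k] inner_diff_right by linarith
  qed
  have "(\<Sum>k\<le>N. q_coeff k \<bullet> q k) = (\<Sum>k<N. \<mu> k \<bullet> q k - lam (Suc k) \<bullet> q (Suc k)) - lam 0 \<bullet> q 0"
    unfolding q_coeff_def sum_nodes_by_parts[symmetric] ..
  moreover have "(\<Sum>k\<le>N. p_coeff k \<bullet> p k) =
      (\<Sum>k<N. chi_left k \<bullet> p k - chi_right k \<bullet> p (Suc k)) - \<psi>0 \<bullet> p 0"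
    unfolding p_coeff_def sum_nodes_by_parts[symmetric] by simp
  ultimately show ?thesis
    unfolding discrete_lagrangian_def inner_diff_right[of "lam 0"] inner_diff_right[of "\<psi>0"]
    using sum.cong[OF refl stage, of "{..<N}"]
    by (simp add: sum.distrib)
qed

section \<open>The KKT equations as adjoint equations\<close>

lemma GDERIV_node:
  assumes "k \<le> N" and "q N \<in> conf M"
  shows "GDERIV (\<lambda>x. discrete_lagrangian M s c N (q(k := x)) p Q P U lam \<mu> \<psi>0 \<Lambda> \<Psi>) (q k) :>
      (if k = N then grad (\<lambda>x. final_cost M x (p N)) (q N) else 0) + q_coeff k"
    and "GDERIV (\<lambda>x. discrete_lagrangian M s c N q (p(k := x)) Q P U lam \<mu> \<psi>0 \<Lambda> \<Psi>) (p k) :>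
      (if k = N then grad (\<lambda>y. final_cost M (q N) y) (p N) else 0) + p_coeff k"
proof -
  have A: "finite {..N}" "k \<in> {..N}"
    using assms by auto
  have "\<exists>K. \<forall>x. discrete_lagrangian M s c N (q(k := x)) p Q P U lam \<mu> \<psi>0 \<Lambda> \<Psi> =
      final_cost M ((q(k := x)) N) (p N) + (q_coeff k \<bullet> x + K)"
    unfolding discrete_lagrangian_regrouped sum_fun_upd[OF A, of "\<lambda>k. (\<bullet>) (q_coeff k)"]
    by (rule exI[of _ "(\<Sum>k\<le>N. q_coeff k \<bullet> q k) - q_coeff k \<bullet> q k + (\<Sum>k\<le>N. p_coeff k \<bullet> p k) +
        (\<Sum>k<N. \<Sum>i=1..s. weighted_ham k i (Q k i) (P k i) (U k i) +
           Q_coeff k i \<bullet> Q k i + P_coeff k i \<bullet> P k i) +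
        (lam 0 \<bullet> q_init M + \<psi>0 \<bullet> p_init M)"]) (simp add: algebra_simps)
  then obtain K where K: "\<And>x. discrete_lagrangian M s c N (q(k := x)) p Q P U lam \<mu> \<psi>0 \<Lambda> \<Psi> =
      final_cost M ((q(k := x)) N) (p N) + (q_coeff k \<bullet> x + K)"
    by blast
  have "\<exists>K. \<forall>x. discrete_lagrangian M s c N q (p(k := x)) Q P U lam \<mu> \<psi>0 \<Lambda> \<Psi> =
      final_cost M (q N) ((p(k := x)) N) + (p_coeff k \<bullet> x + K)"
    unfolding discrete_lagrangian_regrouped sum_fun_upd[OF A, of "\<lambda>k. (\<bullet>) (p_coeff k)"]
    by (rule exI[of _ "(\<Sum>k\<le>N. q_coeff k \<bullet> q k) + (\<Sum>k\<le>N. p_coeff k \<bullet> p k) - p_coeff k \<bullet> p k +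
        (\<Sum>k<N. \<Sum>i=1..s. weighted_ham k i (Q k i) (P k i) (U k i) +
           Q_coeff k i \<bullet> Q k i + P_coeff k i \<bullet> P k i) +
        (lam 0 \<bullet> q_init M + \<psi>0 \<bullet> p_init M)"]) (simp add: algebra_simps)
  then obtain L where L: "\<And>x. discrete_lagrangian M s c N q (p(k := x)) Q P U lam \<mu> \<psi>0 \<Lambda> \<Psi> =
      final_cost M (q N) ((p(k := x)) N) + (p_coeff k \<bullet> x + L)"
    by blast
  have dq: "GDERIV (\<lambda>x. final_cost M ((q(k := x)) N) (p N)) (q k) :>
      (if k = N then grad (\<lambda>x. final_cost M x (p N)) (q N) else 0)"
  proof (cases "k = N")
    case True
    then show ?thesis
      using GDERIV_grad[OF state_maps_differentiable(3)[OF M assms(2), of "p N"]] by simp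
  qed (simp add: GDERIV_const)
  have dp: "GDERIV (\<lambda>x. final_cost M (q N) ((p(k := x)) N)) (p k) :>
      (if k = N then grad (\<lambda>y. final_cost M (q N) y) (p N) else 0)"
  proof (cases "k = N")
    case True
    then show ?thesis
      using GDERIV_grad[OF state_maps_differentiable(4)[OF M assms(2), of "p N"]] by simp
  qed (simp add: GDERIV_const)
  show "GDERIV (\<lambda>x. discrete_lagrangian M s c N (q(k := x)) p Q P U lam \<mu> \<psi>0 \<Lambda> \<Psi>) (q k) :>
      (if k = N then grad (\<lambda>x. final_cost M x (p N)) (q N) else 0) + q_coeff k"
    unfolding K by (rule GDERIV_affine_const[OF dq])
  show "GDERIV (\<lambda>x. discrete_lagrangian M s c N q (p(k := x)) Q P U lam \<mu> \<psi>0 \<Lambda> \<Psi>) (p k) :>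
      (if k = N then grad (\<lambda>y. final_cost M (q N) y) (p N) else 0) + p_coeff k"
    unfolding L by (rule GDERIV_affine_const[OF dp])
qed

lemma GDERIV_stage:
  fixes Q P :: "nat \<Rightarrow> nat \<Rightarrow> real^'n" and U :: "nat \<Rightarrow> nat \<Rightarrow> real^'m"
  assumes "k < N" and "i \<in> {1..s}" and "Q k i \<in> conf M" and "U k i \<in> interior (ctrl M)"
  shows "GDERIV (\<lambda>x. discrete_lagrangian M s c N q p (Q(k := (Q k)(i := x))) P U lam \<mu> \<psi>0 \<Lambda> \<Psi>) (Q k i) :>
      (h * weight i) *\<^sub>R grad (\<lambda>x. hamiltonian M x (P k i) (U k i) (\<Gamma> k i) (chi k i) 1) (Q k i) + Q_coeff k i"
    and "GDERIV (\<lambda>x. discrete_lagrangian M s c N q p Q (P(k := (P k)(i := x))) U lam \<mu> \<psi>0 \<Lambda> \<Psi>) (P k i) :>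
      (h * weight i) *\<^sub>R grad (\<lambda>y. hamiltonian M (Q k i) y (U k i) (\<Gamma> k i) (chi k i) 1) (P k i) + P_coeff k i"
    and "GDERIV (\<lambda>x. discrete_lagrangian M s c N q p Q P (U(k := (U k)(i := x))) lam \<mu> \<psi>0 \<Lambda> \<Psi>) (U k i) :>
      (h * weight i) *\<^sub>R grad (\<lambda>z. hamiltonian M (Q k i) (P k i) z (\<Gamma> k i) (chi k i) 1) (U k i)"
proof -
  \<comment> \<open>The part of the discrete Lagrangian that contains no stage values.\<close>
  define rest where "rest = final_cost M (q N) (p N) + (\<Sum>k\<le>N. q_coeff k \<bullet> q k) +
    (\<Sum>k\<le>N. p_coeff k \<bullet> p k) + (lam 0 \<bullet> q_init M + \<psi>0 \<bullet> p_init M)"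
  define F where "F Q' P' U' k i = weighted_ham k i Q' P' U' + Q_coeff k i \<bullet> Q' + P_coeff k i \<bullet> P'"
    for Q' P' U' k i
  have DL: "discrete_lagrangian M s c N q p Q' P' U' lam \<mu> \<psi>0 \<Lambda> \<Psi> =
      rest + (\<Sum>k<N. \<Sum>i=1..s. F (Q' k i) (P' k i) (U' k i) k i)" for Q' P' U'
    unfolding discrete_lagrangian_regrouped rest_def F_def by simp
  define const where "const = rest + (\<Sum>k<N. \<Sum>i=1..s. F (Q k i) (P k i) (U k i) k i)
     - F (Q k i) (P k i) (U k i) k i"
  note upd = sum_fun_upd2[OF finite_lessThan[of N] _ finite_atLeastAtMost[of 1 s] assms(2)]
  have k: "k \<in> {..<N}"
    using assms(1) by simp
  have Q': "discrete_lagrangian M s c N q p (Q(k := (Q k)(i := x))) P U lam \<mu> \<psi>0 \<Lambda> \<Psi> =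
      weighted_ham k i x (P k i) (U k i) + (Q_coeff k i \<bullet> x + (const + P_coeff k i \<bullet> P k i))" for x
    unfolding DL upd[OF k, of "\<lambda>k i y. F y (P k i) (U k i) k i"] const_def by (simp add: F_def)
  have P': "discrete_lagrangian M s c N q p Q (P(k := (P k)(i := x))) U lam \<mu> \<psi>0 \<Lambda> \<Psi> =
      weighted_ham k i (Q k i) x (U k i) + (P_coeff k i \<bullet> x + (const + Q_coeff k i \<bullet> Q k i))" for x
    unfolding DL upd[OF k, of "\<lambda>k i y. F (Q k i) y (U k i) k i"] const_def by (simp add: F_def)
  have U': "discrete_lagrangian M s c N q p Q P (U(k := (U k)(i := x))) lam \<mu> \<psi>0 \<Lambda> \<Psi> =
      weighted_ham k i (Q k i) (P k i) x + (0 \<bullet> x + (const + Q_coeff k i \<bullet> Q k i + P_coeff k i \<bullet> P k i))" for x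
    unfolding DL upd[OF k, of "\<lambda>k i y. F (Q k i) (P k i) y k i"] const_def by (simp add: F_def)
  have scaled: "GDERIV (\<lambda>x. a * f x) x :> a *\<^sub>R grad f x" if "GDERIV f x :> D"
    for a :: real and f :: "'v::euclidean_space \<Rightarrow> real" and x D
    using that unfolding grad_eqI[OF that] gderiv_def by (auto intro!: derivative_eq_intros)
  note H = GDERIV_hamiltonian[OF M assms(3,4), where p = "P k i" and lam = "\<Gamma> k i" and \<psi> = "chi k i",
      THEN scaled]
  show "GDERIV (\<lambda>x. discrete_lagrangian M s c N q p (Q(k := (Q k)(i := x))) P U lam \<mu> \<psi>0 \<Lambda> \<Psi>) (Q k i) :>
      (h * weight i) *\<^sub>R grad (\<lambda>x. hamiltonian M x (P k i) (U k i) (\<Gamma> k i) (chi k i) 1) (Q k i) + Q_coeff k i"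
    unfolding Q' weighted_ham_def by (intro GDERIV_affine_const H)
  show "GDERIV (\<lambda>x. discrete_lagrangian M s c N q p Q (P(k := (P k)(i := x))) U lam \<mu> \<psi>0 \<Lambda> \<Psi>) (P k i) :>
      (h * weight i) *\<^sub>R grad (\<lambda>y. hamiltonian M (Q k i) y (U k i) (\<Gamma> k i) (chi k i) 1) (P k i) + P_coeff k i"
    unfolding P' weighted_ham_def by (intro GDERIV_affine_const H)
  have "GDERIV (\<lambda>x. discrete_lagrangian M s c N q p Q P (U(k := (U k)(i := x))) lam \<mu> \<psi>0 \<Lambda> \<Psi>) (U k i) :>
      (h * weight i) *\<^sub>R grad (\<lambda>z. hamiltonian M (Q k i) (P k i) z (\<Gamma> k i) (chi k i) 1) (U k i) + 0"
    unfolding U' weighted_ham_def by (intro GDERIV_affine_const H)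
  then show "GDERIV (\<lambda>x. discrete_lagrangian M s c N q p Q P (U(k := (U k)(i := x))) lam \<mu> \<psi>0 \<Lambda> \<Psi>) (U k i) :>
      (h * weight i) *\<^sub>R grad (\<lambda>z. hamiltonian M (Q k i) (P k i) z (\<Gamma> k i) (chi k i) 1) (U k i)"
    by simp
qed

lemma step_weight_nonzero:
  assumes "i \<in> {1..s}"
  shows "h \<noteq> 0" and "weight i \<noteq> 0"
proof -
  have "horizon M > 0"
    using M[unfolded standing_assumptions_def] by (rule conjunct1)
  then show "h \<noteq> 0"
    using N by (simp add: step_size_def)
  show "weight i \<noteq> 0"
    using b assms by force
qed

lemma kkt_iff:
  assumes "q N \<in> conf M"
    and "\<forall>k<N. \<forall>i\<in>{1..s}. Q k i \<in> conf M"
    and "\<forall>k<N. \<forall>i\<in>{1..s}. U k i \<in> interior (ctrl M)"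
  shows "kkt M s c N q p Q P U lam \<mu> \<psi>0 \<Lambda> \<Psi> \<longleftrightarrow>
    (\<forall>k\<le>N. (if k = N then grad (\<lambda>x. final_cost M x (p N)) (q N) else 0) + q_coeff k = 0) \<and>
    (\<forall>k\<le>N. (if k = N then grad (\<lambda>y. final_cost M (q N) y) (p N) else 0) + p_coeff k = 0) \<and>
    (\<forall>k<N. \<forall>i\<in>{1..s}.
      (h * weight i) *\<^sub>R grad (\<lambda>x. hamiltonian M x (P k i) (U k i) (\<Gamma> k i) (chi k i) 1) (Q k i) + Q_coeff k i = 0 \<and>
      (h * weight i) *\<^sub>R grad (\<lambda>y. hamiltonian M (Q k i) y (U k i) (\<Gamma> k i) (chi k i) 1) (P k i) + P_coeff k i = 0 \<and>
      stationary M (Q k i) (P k i) (chi k i) (U k i))"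
proof -
  have *: "GDERIV f x :> 0 \<longleftrightarrow> D = 0" if "GDERIV f x :> D" for f :: "'v::real_inner \<Rightarrow> real" and x D
    using that GDERIV_unique[OF that, of 0] by fast
  have split: "(\<forall>k\<le>N. A k \<and> B k) \<and> (\<forall>k<N. \<forall>i\<in>{1..s}. C k i \<and> D k i \<and> E k i) \<longleftrightarrow>
      (\<forall>k\<le>N. A' k) \<and> (\<forall>k\<le>N. B' k) \<and> (\<forall>k<N. \<forall>i\<in>{1..s}. C' k i \<and> D' k i \<and> E' k i)"
    if "\<And>k. k \<le> N \<Longrightarrow> A k \<longleftrightarrow> A' k" and "\<And>k. k \<le> N \<Longrightarrow> B k \<longleftrightarrow> B' k"
      and "\<And>k i. k < N \<Longrightarrow> i \<in> {1..s} \<Longrightarrow> C k i \<longleftrightarrow> C' k i"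
      and "\<And>k i. k < N \<Longrightarrow> i \<in> {1..s} \<Longrightarrow> D k i \<longleftrightarrow> D' k i"
      and "\<And>k i. k < N \<Longrightarrow> i \<in> {1..s} \<Longrightarrow> E k i \<longleftrightarrow> E' k i"
    for A B A' B' :: "nat \<Rightarrow> bool" and C D E C' D' E' :: "nat \<Rightarrow> nat \<Rightarrow> bool"
    using that by (simp cong: all_cong) auto
  have control: "GDERIV f x :> 0 \<longleftrightarrow> stationary M (Q k i) (P k i) (chi k i) (U k i)"
    if "GDERIV f x :> (h * weight i) *\<^sub>R grad (\<lambda>z. hamiltonian M (Q k i) (P k i) z (\<Gamma> k i) (chi k i) 1) (U k i)"
      and "k < N" and "i \<in> {1..s}" for f :: "real^'m \<Rightarrow> real" and x k i
    using *[OF that(1)] step_weight_nonzero[OF that(3)]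
      stationary_iff_grad_hamiltonian[OF M assms(2,3)[rule_format, OF that(2,3)]] by simp
  show ?thesis
    unfolding kkt_def
    by (intro split *[OF GDERIV_node(1)[where q = q]] *[OF GDERIV_node(2)[where p = p]]
        *[OF GDERIV_stage(1)[where Q = Q]] *[OF GDERIV_stage(2)[where P = P]]
        control[OF GDERIV_stage(3)[where U = U]] assms assms(2,3)[rule_format])
qed

lemma q_node_equations_iff:
  "(\<forall>k\<le>N. (if k = N then G else 0) + q_coeff k = 0) \<longleftrightarrow> (\<forall>k<N. \<mu> k = lam k) \<and> lam N = G"
    (is "?lhs \<longleftrightarrow> _")
proof -
  have "?lhs \<longleftrightarrow> (\<forall>k<N. q_coeff k = 0) \<and> G + q_coeff N = 0"
    by (simp add: le_less all_conj_distrib disj_imp cong: imp_cong) auto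
  also have "\<dots> \<longleftrightarrow> (\<forall>k<N. \<mu> k = lam k) \<and> lam N = G"
    by (simp add: q_coeff_def eq_commute[of _ G] cong: all_cong)
  finally show ?thesis .
qed

text \<open>
  At an interior node the equation says that the polynomials interpolating \<open>chi\<close> on two adjacent
  steps agree at the common end point, so that the node values \<open>\<psi> k\<close> are well defined.
\<close>

lemma p_node_equations_iff:
  "(\<forall>k\<le>N. (if k = N then G else 0) + p_coeff k = 0) \<longleftrightarrow>
     \<psi>0 = chi_left 0 \<and> (\<forall>k. Suc k < N \<longrightarrow> chi_right k = chi_left (Suc k)) \<and> chi_right (N - 1) = G"
    (is "?lhs \<longleftrightarrow> ?rhs")
proof -
  obtain n where n: "N = Suc n"
    using N by (cases N) auto
  have "?lhs \<longleftrightarrow> p_coeff 0 = 0 \<and> (\<forall>k. Suc k < N \<longrightarrow> p_coeff (Suc k) = 0) \<and> G + p_coeff N = 0"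
    (is "_ \<longleftrightarrow> ?mid")
  proof
    assume ?lhs
    then have *: "(if k = N then G else 0) + p_coeff k = 0" if "k \<le> N" for k
      using that by blast
    have "p_coeff k = 0" if "k < N" for k
      using *[of k] that by simp
    then show ?mid
      using *[of N] N by simp
  next
    assume mid: ?mid
    have "p_coeff k = 0" if "k < N" for k
      using mid that by (cases k) simp_all
    then show ?lhs
      using mid by simp
  qed
  also have "\<dots> \<longleftrightarrow> ?rhs"
  proof -
    have "p_coeff 0 = 0 \<longleftrightarrow> \<psi>0 = chi_left 0"
      using N by (simp add: p_coeff_def eq_commute[of \<psi>0])
    moreover have "p_coeff (Suc k) = 0 \<longleftrightarrow> chi_right k = chi_left (Suc k)" if "Suc k < N" for k
      using that by (simp add: p_coeff_def) (rule eq_commute)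
    moreover have "p_coeff N = - chi_right (N - 1)"
      unfolding p_coeff_def by (simp add: n)
    then have "G + p_coeff N = 0 \<longleftrightarrow> chi_right (N - 1) = G"
      by (simp add: eq_commute[of _ G])
    ultimately show ?thesis
      by (simp cong: imp_cong)
  qed
  finally show ?thesis .
qed

lemma stage_equations_iff:
  assumes "k < N" and "i \<in> {1..s}" and "Q \<in> conf M" and "v \<in> interior (ctrl M)"
    and v: "v = u (Q, P, \<Gamma> k i, chi k i)" and "\<mu> k = lam k"
  shows "(h * weight i) *\<^sub>R grad (\<lambda>x. hamiltonian M x P v (\<Gamma> k i) (chi k i) 1) Q + Q_coeff k i = 0 \<longleftrightarrow>
      nu M u Q P (\<Gamma> k i) (chi k i) =
        (1 / (h * weight i)) *\<^sub>R (sg_beta s c i *\<^sub>R lam (Suc k) - sg_alpha s c i *\<^sub>R lam k) +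
        (1 / h) *\<^sub>R (\<Sum>j=1..s. sg_abar s c i j *\<^sub>R \<Gamma> k j)"
    and "(h * weight i) *\<^sub>R grad (\<lambda>y. hamiltonian M Q y v (\<Gamma> k i) (chi k i) 1) P + P_coeff k i = 0 \<longleftrightarrow>
      eta M u Q P (\<Gamma> k i) (chi k i) = (1 / h) *\<^sub>R (\<Sum>j=1..s. sg_a s c i j *\<^sub>R chi k j)"
proof -
  note hb = step_weight_nonzero[OF assms(2)]
  have nu: "nu M u Q P (\<Gamma> k i) (chi k i) = - grad (\<lambda>x. hamiltonian M x P v (\<Gamma> k i) (chi k i) 1) Q"
    unfolding nu_def Let_def v[symmetric]
    by (simp add: grad_eqI[OF GDERIV_hamiltonian(1)[OF M assms(3,4)]])
  have eta: "eta M u Q P (\<Gamma> k i) (chi k i) = - grad (\<lambda>y. hamiltonian M Q y v (\<Gamma> k i) (chi k i) 1) P"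
    unfolding eta_def Let_def v[symmetric]
    by (simp add: grad_eqI[OF GDERIV_hamiltonian(2)[OF M assms(3,4)]])
  show "(h * weight i) *\<^sub>R grad (\<lambda>x. hamiltonian M x P v (\<Gamma> k i) (chi k i) 1) Q + Q_coeff k i = 0 \<longleftrightarrow>
      nu M u Q P (\<Gamma> k i) (chi k i) =
        (1 / (h * weight i)) *\<^sub>R (sg_beta s c i *\<^sub>R lam (Suc k) - sg_alpha s c i *\<^sub>R lam k) +
        (1 / h) *\<^sub>R (\<Sum>j=1..s. sg_abar s c i j *\<^sub>R \<Gamma> k j)"
    unfolding Q_coeff_def nu assms(6) by (rule scaled_equation_iff[OF hb])
  show "(h * weight i) *\<^sub>R grad (\<lambda>y. hamiltonian M Q y v (\<Gamma> k i) (chi k i) 1) P + P_coeff k i = 0 \<longleftrightarrow>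
      eta M u Q P (\<Gamma> k i) (chi k i) = (1 / h) *\<^sub>R (\<Sum>j=1..s. sg_a s c i j *\<^sub>R chi k j)"
    using scaled_equation_iff[OF hb, of _ 0] unfolding P_coeff_def eta by simp
qed

text \<open>
  The KKT equations as adjoint equations, on points where the control is already given by the
  control law.  The equations for \<open>Q\<close> contain \<open>\<mu> k\<close>, and become the discretization of
  \<open>\<nu>\<close> only after \<open>\<mu> k = lam k\<close>, which is part of the equations for the nodes \<open>q k\<close>; hence the
  case distinction in the proof.
\<close>

lemma kkt_iff_adjoint_equations:
  assumes "q N \<in> conf M"
    and "\<forall>k<N. \<forall>i\<in>{1..s}. Q k i \<in> conf M"
    and "\<forall>k<N. \<forall>i\<in>{1..s}. U k i \<in> interior (ctrl M)"
    and "\<forall>k<N. \<forall>i\<in>{1..s}. U k i = u (Q k i, P k i, \<Gamma> k i, chi k i)"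
    and "\<forall>k<N. \<forall>i\<in>{1..s}. stationary M (Q k i) (P k i) (chi k i) (U k i)"
  shows "kkt M s c N q p Q P U lam \<mu> \<psi>0 \<Lambda> \<Psi> \<longleftrightarrow>
    ((\<forall>k<N. \<mu> k = lam k) \<and> lam N = grad (\<lambda>x. final_cost M x (p N)) (q N)) \<and>
    (\<psi>0 = chi_left 0 \<and> (\<forall>k. Suc k < N \<longrightarrow> chi_right k = chi_left (Suc k)) \<and>
      chi_right (N - 1) = grad (\<lambda>y. final_cost M (q N) y) (p N)) \<and>
    (\<forall>k<N. \<forall>i\<in>{1..s}.
      nu M u (Q k i) (P k i) (\<Gamma> k i) (chi k i) =
        (1 / (h * weight i)) *\<^sub>R (sg_beta s c i *\<^sub>R lam (Suc k) - sg_alpha s c i *\<^sub>R lam k) +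
        (1 / h) *\<^sub>R (\<Sum>j=1..s. sg_abar s c i j *\<^sub>R \<Gamma> k j) \<and>
      eta M u (Q k i) (P k i) (\<Gamma> k i) (chi k i) =
        (1 / h) *\<^sub>R (\<Sum>j=1..s. sg_a s c i j *\<^sub>R chi k j))"
    (is "_ \<longleftrightarrow> ?q_nodes \<and> ?p_nodes \<and> (\<forall>k<N. \<forall>i\<in>{1..s}. ?stage k i)")
proof (cases "\<forall>k<N. \<mu> k = lam k")
  case True
  have "((h * weight i) *\<^sub>R grad (\<lambda>x. hamiltonian M x (P k i) (U k i) (\<Gamma> k i) (chi k i) 1) (Q k i) + Q_coeff k i = 0 \<and>
      (h * weight i) *\<^sub>R grad (\<lambda>y. hamiltonian M (Q k i) y (U k i) (\<Gamma> k i) (chi k i) 1) (P k i) + P_coeff k i = 0 \<and>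
      stationary M (Q k i) (P k i) (chi k i) (U k i)) \<longleftrightarrow> ?stage k i" if "k < N" "i \<in> {1..s}" for k i
    using stage_equations_iff[where u = u, OF that assms(2,3,4)[rule_format, OF that] True[rule_format, OF that(1)]]
      assms(5)[rule_format, OF that] by simp
  then have "(\<forall>k<N. \<forall>i\<in>{1..s}.
      (h * weight i) *\<^sub>R grad (\<lambda>x. hamiltonian M x (P k i) (U k i) (\<Gamma> k i) (chi k i) 1) (Q k i) + Q_coeff k i = 0 \<and>
      (h * weight i) *\<^sub>R grad (\<lambda>y. hamiltonian M (Q k i) y (U k i) (\<Gamma> k i) (chi k i) 1) (P k i) + P_coeff k i = 0 \<and>
      stationary M (Q k i) (P k i) (chi k i) (U k i)) \<longleftrightarrow> (\<forall>k<N. \<forall>i\<in>{1..s}. ?stage k i)"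
    by (simp only: cong: all_cong ball_cong)
  then show ?thesis
    by (simp only: kkt_iff[where q = q and p = p and Q = Q and P = P and U = U, OF assms(1-3)] q_node_equations_iff p_node_equations_iff)
next
  case False
  then show ?thesis
    by (simp only: kkt_iff[where q = q and p = p and Q = Q and P = P and U = U, OF assms(1-3)] q_node_equations_iff simp_thms)
qed

text \<open>
  Both sides force \<open>((Q k i, P k i, \<Gamma> k i, chi k i), U k i)\<close> to lie in \<open>\<Omega>\<close> with \<open>U k i\<close> stationary:
  the left one by the KKT equation for \<open>U k i\<close>, the right one because the graph of \<open>u\<close> over the
  domain of \<open>\<Omega>\<close> is contained in \<open>\<Omega>\<close>.  On \<open>\<Omega>\<close>, stationarity amounts to \<open>U k i = u (\<dots>)\<close>, and the
  remaining equations correspond by the previous lemma.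
\<close>

lemma discrete_dualization_iff_sg_bvp:
  assumes law: "control_law M \<Omega> u"
  shows "discrete_dualization M s c N q p Q P U lam \<mu> \<psi>0 \<Lambda> \<Psi> \<and>
      node_multipliers s c N chi \<psi> \<and>
      (\<forall>k<N. \<forall>i\<in>{1..s}. ((Q k i, P k i, \<Gamma> k i, chi k i), U k i) \<in> \<Omega>) \<longleftrightarrow>
    sg_bvp M u s c N q p lam \<psi> Q P \<Gamma> chi \<and>
      (\<forall>k<N. \<mu> k = lam k) \<and> \<psi>0 = \<psi> 0 \<and>
      (\<forall>k<N. \<forall>i\<in>{1..s}. (Q k i, P k i, \<Gamma> k i, chi k i) \<in> Domain \<Omega> \<and>
         U k i = u (Q k i, P k i, \<Gamma> k i, chi k i))"
    (is "?lhs \<longleftrightarrow> ?rhs")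
proof -
  have law': "\<Omega> \<subseteq> (conf M \<times> UNIV \<times> UNIV \<times> UNIV) \<times> interior (ctrl M)"
    "\<forall>w\<in>Domain \<Omega>. (w, u w) \<in> \<Omega>"
    "\<forall>q p lam \<psi> v. ((q, p, lam, \<psi>), v) \<in> \<Omega> \<longrightarrow> (stationary M q p \<psi> v \<longleftrightarrow> v = u (q, p, lam, \<psi>))"
    using law unfolding control_law_def by simp_all
  have \<Omega>: "Q \<in> conf M" "v \<in> interior (ctrl M)" "v \<in> ctrl M"
    if "((Q, P, \<Gamma>, chi), v) \<in> \<Omega>" for Q P \<Gamma> chi v
    using law'(1) that interior_subset[of "ctrl M"] by blast+
  have stat_iff: "stationary M Q P chi v \<longleftrightarrow> v = u (Q, P, \<Gamma>, chi)"
    if "((Q, P, \<Gamma>, chi), v) \<in> \<Omega>" for Q P \<Gamma> chi v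
    using law'(3) that by blast
  show ?thesis
  proof
    assume ?lhs
    then have con: "sg_constraints M s c N q p Q P U" and kkt: "kkt M s c N q p Q P U lam \<mu> \<psi>0 \<Lambda> \<Psi>"
      and node: "node_multipliers s c N chi \<psi>"
      and in_\<Omega>: "\<forall>k<N. \<forall>i\<in>{1..s}. ((Q k i, P k i, \<Gamma> k i, chi k i), U k i) \<in> \<Omega>"
      unfolding discrete_dualization_def by blast+
    note con' = con[unfolded sg_constraints_def]
    have qN: "q N \<in> conf M"
      using con' by blast
    have in_domain: "\<forall>k<N. \<forall>i\<in>{1..s}. Q k i \<in> conf M" "\<forall>k<N. \<forall>i\<in>{1..s}. U k i \<in> interior (ctrl M)"
      using \<Omega>(1,2) in_\<Omega> by blast+
    have stat: "\<forall>k<N. \<forall>i\<in>{1..s}. stationary M (Q k i) (P k i) (chi k i) (U k i)"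
      using kkt[unfolded kkt_iff[where q = q and p = p and Q = Q and P = P and U = U, OF qN in_domain]] by blast
    have U: "\<forall>k<N. \<forall>i\<in>{1..s}. U k i = u (Q k i, P k i, \<Gamma> k i, chi k i)"
      using stat stat_iff in_\<Omega> by blast
    note adj = kkt[unfolded kkt_iff_adjoint_equations[where q = q and p = p and Q = Q and P = P and U = U and u = u,
        OF qN in_domain U stat]]
    have \<psi>: "\<And>k. k < N \<Longrightarrow> \<psi> k = chi_left k" "\<psi> N = chi_right (N - 1)"
      using node unfolding node_multipliers_def by blast+
    have \<psi>_Suc: "\<psi> (Suc k) = chi_right k" if "k < N" for k
    proof (cases "Suc k < N")
      case True
      then show ?thesis
        using adj \<psi>(1)[OF True] by presburger
    next
      case False
      then have "N = Suc k"
        using that by simp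
      then show ?thesis
        using \<psi>(2) by simp
    qed
    have "sg_bvp M u s c N q p lam \<psi> Q P \<Gamma> chi"
      unfolding sg_bvp_def mom_law_def
    proof (intro conjI allI impI ballI)
      show "mom M (Q k i) (P k i) (u (Q k i, P k i, \<Gamma> k i, chi k i)) =
          (1 / (h * weight i)) *\<^sub>R (sg_beta s c i *\<^sub>R p (Suc k) - sg_alpha s c i *\<^sub>R p k) +
          (1 / h) *\<^sub>R (\<Sum>j=1..s. sg_abar s c i j *\<^sub>R P k j)"
        if "k < N" "i \<in> {1..s}" for k i
        using con' U[rule_format, OF that, symmetric] that by simp
      show "\<psi> N = grad (\<lambda>y. final_cost M (q N) y) (p N)"
        using \<psi>(2) adj by presburger
    qed (use con' adj \<psi>(1) \<psi>_Suc U in \<open>simp_all only: simp_thms\<close>)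
    moreover have "\<psi>0 = \<psi> 0"
      using adj \<psi>(1)[of 0] N by simp
    ultimately show ?rhs
      using adj U in_\<Omega> by (blast intro: DomainI)
  next
    assume rhs: ?rhs
    note bvp = rhs[THEN conjunct1, unfolded sg_bvp_def mom_law_def]
    have U: "\<forall>k<N. \<forall>i\<in>{1..s}. U k i = u (Q k i, P k i, \<Gamma> k i, chi k i)"
      and in_Domain: "\<forall>k<N. \<forall>i\<in>{1..s}. (Q k i, P k i, \<Gamma> k i, chi k i) \<in> Domain \<Omega>"
      using rhs by blast+
    have in_\<Omega>: "\<forall>k<N. \<forall>i\<in>{1..s}. ((Q k i, P k i, \<Gamma> k i, chi k i), U k i) \<in> \<Omega>"
      using law'(2) in_Domain U by metis
    have in_domain: "\<forall>k<N. \<forall>i\<in>{1..s}. Q k i \<in> conf M" "\<forall>k<N. \<forall>i\<in>{1..s}. U k i \<in> interior (ctrl M)"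
      using \<Omega>(1,2) in_\<Omega> by blast+
    have stat: "\<forall>k<N. \<forall>i\<in>{1..s}. stationary M (Q k i) (P k i) (chi k i) (U k i)"
      using U stat_iff in_\<Omega> by blast
    have \<psi>: "\<psi> k = chi_left k" "\<psi> (Suc k) = chi_right k" if "k < N" for k
      using bvp that by blast+
    have \<psi>N: "\<psi> N = chi_right (N - 1)"
      using \<psi>(2)[of "N - 1"] N by simp
    have node: "node_multipliers s c N chi \<psi>"
      unfolding node_multipliers_def using \<psi>(1) \<psi>N by blast
    have qN: "q N \<in> conf M"
      using bvp by blast
    have kkt: "kkt M s c N q p Q P U lam \<mu> \<psi>0 \<Lambda> \<Psi>"
      unfolding kkt_iff_adjoint_equations[where q = q and p = p and Q = Q and P = P and U = U and u = u,
        OF qN in_domain U stat]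
    proof (intro conjI allI impI ballI)
      show "\<psi>0 = chi_left 0"
        using rhs \<psi>(1)[of 0] N by simp
      show "chi_right k = chi_left (Suc k)" if "Suc k < N" for k
        using \<psi>(1)[OF that] \<psi>(2)[of k] that by simp
      show "chi_right (N - 1) = grad (\<lambda>y. final_cost M (q N) y) (p N)"
        using \<psi>N bvp by presburger
    qed (use rhs bvp in \<open>simp_all only: simp_thms\<close>)
    have con: "sg_constraints M s c N q p Q P U"
      unfolding sg_constraints_def
    proof (intro conjI allI impI ballI)
      show "mom M (Q k i) (P k i) (U k i) =
          (1 / (h * weight i)) *\<^sub>R (sg_beta s c i *\<^sub>R p (Suc k) - sg_alpha s c i *\<^sub>R p k) +
          (1 / h) *\<^sub>R (\<Sum>j=1..s. sg_abar s c i j *\<^sub>R P k j)"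
        if "k < N" "i \<in> {1..s}" for k i
        using bvp U[rule_format, OF that] that by simp
      show "U k i \<in> ctrl M" if "k < N" "i \<in> {1..s}" for k i
        using \<Omega>(3) in_\<Omega> that by blast
    qed (use bvp U in \<open>simp_all only: simp_thms\<close>)
    show ?lhs
      using con kkt node in_\<Omega> unfolding discrete_dualization_def by blast
  qed
qed

end

section \<open>Dualization and discretization commute\<close>

theorem theorem5p2:
  fixes M :: "('n::finite, 'm::finite) ocp"
    and q\<^sub>o p\<^sub>o lam\<^sub>o \<psi>\<^sub>o :: "real \<Rightarrow> real^'n" and u\<^sub>o :: "real \<Rightarrow> real^'m"
    and s :: nat and c :: "nat \<Rightarrow> real"
  assumes "standing_assumptions M"
    and "regular_lagrangian M"
    and "uniformly_coercive M" and "cost_smooth_in_state M"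
    and "unique_ocp_solution M q\<^sub>o p\<^sub>o u\<^sub>o"
    and "AE t in lebesgue_on {0..horizon M}. u\<^sub>o t \<in> interior (ctrl M)"
    and "adjoint_variables M q\<^sub>o p\<^sub>o u\<^sub>o lam\<^sub>o \<psi>\<^sub>o"
    and "AE t in lebesgue_on {0..horizon M}.
           sym_pos_def (hess (\<lambda>v. hamiltonian M (q\<^sub>o t) (p\<^sub>o t) v (lam\<^sub>o t) (\<psi>\<^sub>o t) 1) (u\<^sub>o t))"
    and "collocation_points s c" and "convergent_sg M s c" and "\<forall>i\<in>{1..s}. sg_b s c i > 0"
  shows
    "(AE t in lebesgue_on {0..horizon M}.
        \<exists>\<Omega> u. open \<Omega> \<and> ((q\<^sub>o t, p\<^sub>o t, lam\<^sub>o t, \<psi>\<^sub>o t), u\<^sub>o t) \<in> \<Omega> \<and>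
               control_law M \<Omega> u \<and> continuous_on (Domain \<Omega>) u) \<and>
     (\<forall>\<Omega> u (N::nat) q p Q P U lam \<mu> \<psi>0 \<Lambda> \<Psi> \<Gamma> chi \<psi>.
        control_law M \<Omega> u \<and> 1 \<le> N \<and> stage_multipliers s c N \<Lambda> \<Psi> \<Gamma> chi \<longrightarrow>
        (discrete_dualization M s c N q p Q P U lam \<mu> \<psi>0 \<Lambda> \<Psi> \<and>
         node_multipliers s c N chi \<psi> \<and>
         (\<forall>k<N. \<forall>i\<in>{1..s}. ((Q k i, P k i, \<Gamma> k i, chi k i), U k i) \<in> \<Omega>)
         \<longleftrightarrow>
         sg_bvp M u s c N q p lam \<psi> Q P \<Gamma> chi \<and>
         (\<forall>k<N. \<mu> k = lam k) \<and> \<psi>0 = \<psi> 0 \<and>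
         (\<forall>k<N. \<forall>i\<in>{1..s}. (Q k i, P k i, \<Gamma> k i, chi k i) \<in> Domain \<Omega> \<and>
            U k i = u (Q k i, P k i, \<Gamma> k i, chi k i))))"
proof (rule conjI)
  have "admissible M q\<^sub>o p\<^sub>o u\<^sub>o"
    using assms(5) by (simp add: unique_ocp_solution_def ocp_solution_def)
  then have "\<forall>t\<in>{0..horizon M}. q\<^sub>o t \<in> conf M"
    by (simp add: admissible_def)
  then have "AE t in lebesgue_on {0..horizon M}. q\<^sub>o t \<in> conf M"
    by (intro AE_I2) simp
  moreover have "AE t in lebesgue_on {0..horizon M}. stationary M (q\<^sub>o t) (p\<^sub>o t) (\<psi>\<^sub>o t) (u\<^sub>o t)"
    using assms(7) unfolding adjoint_variables_def by (auto elim: eventually_mono)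
  ultimately show "AE t in lebesgue_on {0..horizon M}.
        \<exists>\<Omega> u. open \<Omega> \<and> ((q\<^sub>o t, p\<^sub>o t, lam\<^sub>o t, \<psi>\<^sub>o t), u\<^sub>o t) \<in> \<Omega> \<and>
               control_law M \<Omega> u \<and> continuous_on (Domain \<Omega>) u"
    using assms(6,8) by eventually_elim (rule control_law_exists[OF assms(1)])
qed (intro allI impI, elim conjE, rule discrete_dualization_iff_sg_bvp[OF assms(1,11)])

end
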